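(* Let $(G,J)$ be a simply-connected, $2$-step nilpotent Lie group equipped with a left-invariant complex structure $J$, and assume that the Lie algebra $(\mathfrak g,\mu)$ of $G$ is such that $J$ preserves the commutators, i.e. $J\mu(\mathfrak g,\mathfrak g)\subseteq\mu(\mathfrak g,\mathfrak g)$. Then, for every left-invariant Hermitian initial metric $g_0$, the flow $\partial_t g_t=-\mathrm{Ric}^{1,1}(g_t)$, $g_t|_{t=0}=g_0$, has a long-time solution, i.e. a (left-invariant) solution defined for all $t\in[0,\infty)$.
   Context: $\mathrm{Ric}^{1,1}(g)$ denotes the $J$-invariant ($(1,1)$-) component of the Riemannian Ricci tensor of the Levi-Civita connection of $g$. *)

theory Defs
  imports "HOL-Analysis.Analysis"
begin

text \<open>A left-invariant structure on a simply-connected Lie group G is the same as the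
corresponding structure on its Lie algebra g, which we model as real^'n with a bracket mu.
Inner products on g are represented by their Gram matrices w.r.t. the standard basis.\<close>

definition lie_bracket :: "(real^'n \<Rightarrow> real^'n \<Rightarrow> real^'n) \<Rightarrow> bool" where
  "lie_bracket mu \<longleftrightarrow> bilinear mu \<and> (\<forall>x y. mu x y = - mu y x) \<and>
     (\<forall>x y z. mu x (mu y z) + mu y (mu z x) + mu z (mu x y) = 0)"

definition two_step_nilpotent :: "(real^'n \<Rightarrow> real^'n \<Rightarrow> real^'n) \<Rightarrow> bool" where
  "two_step_nilpotent mu \<longleftrightarrow> (\<forall>x y z. mu (mu x y) z = 0) \<and> (\<exists>x y. mu x y \<noteq> 0)"

definition commutator :: "(real^'n \<Rightarrow> real^'n \<Rightarrow> real^'n) \<Rightarrow> (real^'n) set" where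
  "commutator mu = span {mu x y | x y. True}"

definition complex_structure :: "(real^'n \<Rightarrow> real^'n \<Rightarrow> real^'n) \<Rightarrow> real^'n^'n \<Rightarrow> bool" where
  "complex_structure mu J \<longleftrightarrow> J ** J = - mat 1 \<and>
     (\<forall>x y. mu (J *v x) (J *v y) - J *v (mu (J *v x) y) - J *v (mu x (J *v y)) - mu x y = 0)"

definition ip :: "real^'n^'n \<Rightarrow> real^'n \<Rightarrow> real^'n \<Rightarrow> real" where
  "ip G x y = x \<bullet> (G *v y)"

definition inner_product_matrix :: "real^'n^'n \<Rightarrow> bool" where
  "inner_product_matrix G \<longleftrightarrow> transpose G = G \<and> (\<forall>x. x \<noteq> 0 \<longrightarrow> ip G x x > 0)"

definition hermitian :: "real^'n^'n \<Rightarrow> real^'n^'n \<Rightarrow> bool" where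
  "hermitian J G \<longleftrightarrow> inner_product_matrix G \<and> (\<forall>x y. ip G (J *v x) (J *v y) = ip G x y)"

text \<open>Levi-Civita connection of a left-invariant metric via the Koszul formula
  2 g(\<nabla>_X Y, Z) = g([X,Y],Z) - g([Y,Z],X) + g([Z,X],Y).\<close>
definition LC :: "real^'n^'n \<Rightarrow> (real^'n \<Rightarrow> real^'n \<Rightarrow> real^'n) \<Rightarrow> real^'n \<Rightarrow> real^'n \<Rightarrow> real^'n" where
  "LC G mu X Y = matrix_inv G *v (\<chi> k. (ip G (mu X Y) (axis k 1) - ip G (mu Y (axis k 1)) X
                                        + ip G (mu (axis k 1) X) Y) / 2)"

definition curv :: "real^'n^'n \<Rightarrow> (real^'n \<Rightarrow> real^'n \<Rightarrow> real^'n) \<Rightarrow> real^'n \<Rightarrow> real^'n \<Rightarrow> real^'n \<Rightarrow> real^'n" where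
  "curv G mu X Y Z = LC G mu X (LC G mu Y Z) - LC G mu Y (LC G mu X Z) - LC G mu (mu X Y) Z"

definition ricci :: "real^'n^'n \<Rightarrow> (real^'n \<Rightarrow> real^'n \<Rightarrow> real^'n) \<Rightarrow> real^'n \<Rightarrow> real^'n \<Rightarrow> real" where
  "ricci G mu X Y = (\<Sum>i\<in>UNIV. (curv G mu (axis i 1) X Y) $ i)"

definition ric11 :: "real^'n^'n \<Rightarrow> (real^'n \<Rightarrow> real^'n \<Rightarrow> real^'n) \<Rightarrow> real^'n^'n \<Rightarrow> real^'n^'n" where
  "ric11 G mu J = (\<chi> i j. (ricci G mu (axis i 1) (axis j 1)
                            + ricci G mu (J *v axis i 1) (J *v axis j 1)) / 2)"

end

theory Submission
  imports Defs
begin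

text \<open>Let \<open>V\<close> be the commutator and \<open>W\<close> its \<open>g\<^sub>0\<close>-orthogonal complement. In the two-step case the
  Ricci form is \<open>1/4 G M G - 1/2 R\<close>, where \<open>M\<close> is a bivector on \<open>V\<close> depending quadratically on the
  inverse of the metric on \<open>W\<close>, and \<open>R\<close> is a form vanishing on \<open>V\<close>. As \<open>J\<close> preserves \<open>V\<close> and the
  metric, the splitting \<open>V + W\<close> is preserved by the flow. Writing \<open>h\<close> for the metric on \<open>W\<close> and \<open>p\<close> for
  the \<^emph>\<open>inverse\<close> of the metric on \<open>V\<close>, the flow becomes \<open>h' = F\<^sub>1 (h\<inverse>, p\<inverse>)\<close>,
  \<open>p' = F\<^sub>2 (h\<inverse>, h\<inverse>)\<close> with \<open>F\<^sub>1, F\<^sub>2\<close> bilinear and positive semidefinite on semidefinite arguments.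
  So \<open>h\<close> and \<open>p\<close> can only grow; on \<open>{h \<ge> h\<^sub>0, p \<ge> p\<^sub>0}\<close> inverses are bounded and Lipschitz, hence the
  field is globally Lipschitz there, points into the cone, and the solution never stops.
  To avoid matrices on subspaces, \<open>h\<close> and \<open>p\<close> are represented by full-size matrices \<open>H\<close> and \<open>P\<close> that
  agree with \<open>g\<^sub>0\<close> and \<open>g\<^sub>0\<inverse>\<close> on the other summand.\<close>

section \<open>Ordinary differential equations on a closed convex cone\<close>

text \<open>Integrating an exponential of rate \<open>c\<close> gains a factor \<open>1 / c\<close>;
  this is the source of the contraction constant below. The primitive
  \<open>B / c * exp (c * s)\<close> has a nonnegative value at \<open>0\<close>, which is
  dropped.\<close>

lemma integral_norm_exp_bound:
  fixes f :: "real \<Rightarrow> 'a::banach"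
  assumes "continuous_on {0..t} f" "0 \<le> t" "0 < c" "0 \<le> B"
    and le: "\<And>s. s \<in> {0..t} \<Longrightarrow> norm (f s) \<le> B * exp (c * s)"
  shows "norm (integral {0..t} f) \<le> B / c * exp (c * t)"
proof -
  have "((\<lambda>s. B * exp (c * s)) has_integral (B / c * exp (c * t) - B / c * exp (c * 0))) {0..t}"
    by (rule fundamental_theorem_of_calculus)
       (use assms in \<open>auto intro!: derivative_eq_intros simp: has_real_derivative_iff_has_vector_derivative[symmetric]\<close>)
  then have "norm (integral {0..t} f) \<le> B / c * exp (c * t) - B / c * exp (c * 0)"
    using Henstock_Kurzweil_Integration.integral_norm_bound_integral[OF integrable_continuous_real[OF assms(1)]]
      le by (metis has_integral_iff)
  then show ?thesis
    using divide_nonneg_pos[OF assms(4,3)] by simp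
qed

text \<open>The weight \<open>exp (- c * t)\<close> makes the Picard operator a contraction on the whole half line.\<close>

lemma global_solution_lipschitz:
  fixes F :: "'a::banach \<Rightarrow> 'a"
  assumes F: "L-lipschitz_on UNIV F"
  shows "\<exists>u. u 0 = u0 \<and> (\<forall>t\<ge>0. (u has_vector_derivative F (u t)) (at t within {0..}))"
proof -
  \<comment> \<open>Any rate above \<open>L\<close> makes \<open>L / c\<close> less than one; the
    summand \<open>1\<close> keeps \<open>c\<close> positive when \<open>L\<close> is zero.\<close>
  define c where "c = 2 * L + 1"
  have L0: "0 \<le> L" using F by (rule lipschitz_on_nonneg)
  then have c0: "c > 0" by (simp add: c_def)
  have cF: "continuous_on S F" for S
    using lipschitz_on_continuous_on[OF F] continuous_on_subset by blast
  \<comment> \<open>The unknown \<open>v\<close> is the solution damped by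
    \<open>exp (- c * s)\<close>, so it can be sought among the bounded continuous
    functions.\<close>
  define f where "f v s = F (exp (c * s) *\<^sub>R apply_bcontfun v s)" for v :: "real \<Rightarrow>\<^sub>C 'a" and s
  have cf: "continuous_on S (f v)" for S v
    unfolding f_def by (intro continuous_on_compose2[OF cF[of UNIV]] continuous_intros) auto
  \<comment> \<open>Bounded continuous functions live on the whole real line, so the damped Picard
    operator is frozen at its value at \<open>0\<close> for negative times.\<close>
  define \<Psi> where "\<Psi> v t = exp (- (c * max 0 t)) *\<^sub>R (u0 + integral {0..max 0 t} (f v))" for v t
  have dI: "((\<lambda>t. integral {0..t} (f v)) has_vector_derivative f v t) (at t within {0..})"
    if "t \<ge> 0" for v t
  proof -
    have "((\<lambda>t. integral {0..t} (f v)) has_vector_derivative f v t) (at t within {0..t+1})"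
      using that by (intro integral_has_vector_derivative cf) auto
    moreover have "at t within {0..t+1} = at t within {0..}"
      by (rule at_within_nhd[of _ "{..<t+1}"]) auto
    ultimately show ?thesis by simp
  qed
  then have cI: "continuous_on {0..} (\<lambda>t. integral {0..t} (f v))" for v
    by (intro continuous_on_vector_derivative[of _ _ "f v"]) auto
  have c\<Psi>: "continuous_on UNIV (\<Psi> v)" for v
    unfolding \<Psi>_def
    by (intro continuous_intros continuous_on_compose2[OF cI]) auto
  \<comment> \<open>Linear growth of \<open>F\<close>; the constant \<open>norm (F 0)\<close> is
    absorbed because \<open>exp (c * s)\<close> is at least one.\<close>
  have nf: "norm (f v s) \<le> (norm (F 0) + L * norm v) * exp (c * s)" if "s \<ge> 0" for v s
  proof -
    have "norm (f v s - F 0) \<le> L * norm (exp (c * s) *\<^sub>R apply_bcontfun v s - 0)"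
      unfolding f_def by (rule lipschitz_on_normD[OF F]) auto
    also have "\<dots> = L * (exp (c * s) * norm (apply_bcontfun v s))" by simp
    also have "\<dots> \<le> L * (exp (c * s) * norm v)"
      using L0 norm_bounded[of v s] by (intro mult_left_mono) auto
    finally have *: "norm (f v s - F 0) \<le> L * norm v * exp (c * s)" by (simp add: mult_ac)
    have "1 \<le> exp (c * s)" using c0 that by simp
    then have "norm (F 0) * 1 \<le> norm (F 0) * exp (c * s)" by (intro mult_left_mono) auto
    then show ?thesis using * norm_triangle_sub[of "f v s" "F 0"] by (simp add: distrib_right)
  qed
  have b\<Psi>: "norm (\<Psi> v t) \<le> norm u0 + (norm (F 0) + L * norm v) / c" for v t
  proof -
    define T where "T = max 0 t"
    have T0: "0 \<le> T" by (simp add: T_def)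
    have "norm (integral {0..T} (f v)) \<le> (norm (F 0) + L * norm v) / c * exp (c * T)"
      by (rule integral_norm_exp_bound[OF cf T0 c0]) (use nf L0 in auto)
    moreover have "norm u0 * 1 \<le> norm u0 * exp (c * T)"
      using c0 T0 by (intro mult_left_mono) auto
    ultimately have "norm (u0 + integral {0..T} (f v))
       \<le> (norm u0 + (norm (F 0) + L * norm v) / c) * exp (c * T)"
      using norm_triangle_ineq[of u0 "integral {0..T} (f v)"] by (simp add: distrib_right)
    then have "exp (- (c * T)) * norm (u0 + integral {0..T} (f v))
       \<le> exp (- (c * T)) * ((norm u0 + (norm (F 0) + L * norm v) / c) * exp (c * T))"
      by (intro mult_left_mono) auto
    also have "\<dots> = norm u0 + (norm (F 0) + L * norm v) / c"
      by (simp add: exp_minus)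
    finally show ?thesis by (simp add: \<Psi>_def T_def)
  qed
  define \<Phi> where "\<Phi> v = Bcontfun (\<Psi> v)" for v
  have \<Phi>: "apply_bcontfun (\<Phi> v) = \<Psi> v" for v
    unfolding \<Phi>_def by (rule Bcontfun_inverse, rule bcontfun_normI[OF c\<Psi> b\<Psi>])
  have con: "dist (\<Phi> v) (\<Phi> w) \<le> L / c * dist v w" for v w
  proof (rule dist_bound)
    fix t :: real
    define T where "T = max 0 t"
    have T0: "0 \<le> T" by (simp add: T_def)
    have "norm (integral {0..T} (\<lambda>s. f v s - f w s)) \<le> (L * dist v w) / c * exp (c * T)"
    proof (rule integral_norm_exp_bound[OF _ T0 c0])
      fix s assume "s \<in> {0..T}"
      have "norm (f v s - f w s) \<le> L * norm (exp (c * s) *\<^sub>R v s - exp (c * s) *\<^sub>R w s)"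
        unfolding f_def by (rule lipschitz_on_normD[OF F]) auto
      also have "\<dots> = L * (exp (c * s) * dist (v s) (w s))"
        by (simp add: dist_norm scaleR_diff_right[symmetric])
      also have "\<dots> \<le> L * (exp (c * s) * dist v w)"
        using L0 dist_bounded[of v s w] by (intro mult_left_mono) auto
      finally show "norm (f v s - f w s) \<le> L * dist v w * exp (c * s)" by (simp add: mult_ac)
    qed (use L0 in \<open>auto intro!: continuous_intros cf\<close>)
    also have "integral {0..T} (\<lambda>s. f v s - f w s) = integral {0..T} (f v) - integral {0..T} (f w)"
      by (intro integral_diff integrable_continuous_real cf)
    finally have "exp (- (c * T)) * norm (integral {0..T} (f v) - integral {0..T} (f w))
       \<le> exp (- (c * T)) * ((L * dist v w) / c * exp (c * T))"
      by (intro mult_left_mono) auto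
    also have "\<dots> = L / c * dist v w" by (simp add: exp_minus)
    finally show "dist (\<Phi> v t) (\<Phi> w t) \<le> L / c * dist v w"
      by (simp add: \<Phi> \<Psi>_def T_def[symmetric] dist_norm scaleR_diff_right[symmetric])
  qed
  have "\<exists>!v. \<Phi> v = v"
    by (rule banach_fix_type[of "L / c"]) (use L0 c0 con in \<open>auto simp: c_def\<close>)
  then obtain v where v: "\<Phi> v = v" by blast
  \<comment> \<open>Removing the damping: at the fixed point, \<open>u t\<close> is
    \<open>exp (c * t)\<close> times \<open>v t\<close> for \<open>t \<ge> 0\<close>, so the
    integrand is \<open>F (u t)\<close>.\<close>
  define u where "u t = u0 + integral {0..t} (f v)" for t
  have fu: "f v t = F (u t)" if "t \<ge> 0" for t
  proof -
    have "apply_bcontfun v t = \<Psi> v t" using v \<Phi> by metis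
    then show ?thesis using that by (simp add: f_def u_def \<Psi>_def exp_minus)
  qed
  show ?thesis
  proof (intro exI[of _ u] conjI allI impI)
    show "u 0 = u0" by (simp add: u_def)
    fix t :: real assume t: "0 \<le> t"
    have "(u has_vector_derivative f v t) (at t within {0..})"
      unfolding u_def using has_vector_derivative_add[OF has_vector_derivative_const dI[OF t]] by simp
    then show "(u has_vector_derivative F (u t)) (at t within {0..})"
      using fu[OF t] by simp
  qed
qed

text \<open>If the increment left \<open>K\<close>, a hyperplane would separate it from
  \<open>K\<close>. Since \<open>K\<close> is a cone, the separating functional is nonnegative on
  \<open>K\<close>, and the mean value theorem for this functional along \<open>u\<close>
  contradicts the separation.\<close>

lemma closed_convex_cone_increment:
  fixes u :: "real \<Rightarrow> 'a::euclidean_space"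
  assumes K: "convex_cone K" "closed K"
    and u: "\<And>t. t \<ge> 0 \<Longrightarrow> (u has_vector_derivative u' t) (at t within {0..})"
    and u': "\<And>t. t \<ge> 0 \<Longrightarrow> u' t \<in> K" and t: "t \<ge> 0"
  shows "u t - u 0 \<in> K"
proof (rule ccontr)
  assume "u t - u 0 \<notin> K"
  then obtain a b where ab: "a \<bullet> (u t - u 0) < b" "\<And>x. x \<in> K \<Longrightarrow> b < a \<bullet> x"
    using separating_hyperplane_closed_point[of K "u t - u 0"] K unfolding convex_cone_def by metis
  have b0: "b < 0" using ab(2)[of 0] K(1) convex_cone_iff by fastforce
  have a: "0 \<le> a \<bullet> x" if "x \<in> K" for x
  proof (rule ccontr)
    assume n: "\<not> 0 \<le> a \<bullet> x"
    \<comment> \<open>Rescaling a point of negative value by this nonnegative factor reaches the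
      level \<open>b\<close> exactly, which strict separation excludes.\<close>
    then have "(b / (a \<bullet> x)) *\<^sub>R x \<in> K"
      using K(1) that b0 by (auto simp: convex_cone_iff divide_nonpos_neg)
    from ab(2)[OF this] n show False by simp
  qed
  have "\<exists>x\<in>{0..t}. a \<bullet> u t - a \<bullet> u 0 = (\<lambda>h. h *\<^sub>R (a \<bullet> u' x)) (t - 0)"
  proof (rule mvt_very_simple[OF t])
    fix x assume "0 \<le> x" "x \<le> t"
    then have "(u has_vector_derivative u' x) (at x within {0..t})"
      by (intro has_vector_derivative_within_subset[OF u]) auto
    then show "((\<lambda>x. a \<bullet> u x) has_derivative (\<lambda>h. h *\<^sub>R (a \<bullet> u' x))) (at x within {0..t})"
      unfolding has_vector_derivative_def by (auto intro!: derivative_eq_intros)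
  qed
  then obtain x where "x \<in> {0..t}" "a \<bullet> u t - a \<bullet> u 0 = t * (a \<bullet> u' x)" by auto
  then have "0 \<le> a \<bullet> u t - a \<bullet> u 0" using a[OF u'[of x]] t by simp
  then show False using ab(1) b0 by (simp add: inner_diff_right)
qed

text \<open>Extending the vector field by composition with the nearest-point projection onto \<open>u0 + K\<close>
  preserves the Lipschitz constant, and the solution never leaves \<open>u0 + K\<close>.\<close>

lemma global_solution_in_cone:
  fixes F :: "'a::euclidean_space \<Rightarrow> 'a"
  assumes K: "convex_cone K" "closed K"
    and L: "L-lipschitz_on {x. x - u0 \<in> K} F"
    and FK: "\<And>x. x - u0 \<in> K \<Longrightarrow> F x \<in> K"
  shows "\<exists>u. u 0 = u0 \<and> (\<forall>t\<ge>0. u t - u0 \<in> K \<and> (u has_vector_derivative F (u t)) (at t within {0..}))"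
proof -
  define D where "D = {x. x - u0 \<in> K}"
  have D_eq: "D = (+) u0 ` K" by (force simp: D_def image_iff)
  have D: "closed D" "convex D" "D \<noteq> {}"
    using K by (auto simp: D_eq convex_cone_def closed_translation convex_translation)
  define p where "p = closest_point D"
  have p: "p x \<in> D" for x unfolding p_def using D by (intro closest_point_in_set)
  have "(L * 1)-lipschitz_on UNIV (F \<circ> p)"
  proof (rule lipschitz_on_compose)
    show "1-lipschitz_on UNIV p"
      by (rule lipschitz_onI) (use closest_point_lipschitz D in \<open>auto simp: p_def\<close>)
    show "L-lipschitz_on (range p) F"
      using L p unfolding D_def[symmetric] by (rule_tac lipschitz_on_subset) auto
  qed
  then obtain u where u: "u 0 = u0"
    "\<And>t. t \<ge> 0 \<Longrightarrow> (u has_vector_derivative F (p (u t))) (at t within {0..})"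
    using global_solution_lipschitz[of "L * 1" "F \<circ> p" u0] by auto
  have "u t - u 0 \<in> K" if "t \<ge> 0" for t
    by (rule closed_convex_cone_increment[OF K u(2) _ that]) (use p FK in \<open>auto simp: D_def\<close>)
  \<comment> \<open>Along the solution the projection is the identity, so the extended equation is
    the original one.\<close>
  moreover from this have "p (u t) = u t" if "t \<ge> 0" for t
    using that u(1) by (auto simp: p_def D_def intro!: closest_point_self)
  ultimately show ?thesis using u by (intro exI[of _ u]) auto
qed

section \<open>Matrices and positive semidefinite forms\<close>

lemma bounded_bilinear_matrix_matrix_mult:
  "bounded_bilinear ((**) :: real^'n^'m \<Rightarrow> real^'p^'n \<Rightarrow> real^'p^'m)"
  unfolding bilinear_conv_bounded_bilinear[symmetric] bilinear_def
  by (auto intro!: linearI simp: matrix_matrix_mult_def vec_eq_iff distrib_left distrib_right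
      sum.distrib sum_distrib_left mult.assoc mult.left_commute)

interpretation matrix_mult: bounded_bilinear "(**) :: real^'n^'m \<Rightarrow> real^'p^'n \<Rightarrow> real^'p^'m"
  by (rule bounded_bilinear_matrix_matrix_mult)

lemma bounded_bilinear_matrix_vector_mult:
  "bounded_bilinear ((*v) :: real^'n^'m \<Rightarrow> real^'n \<Rightarrow> real^'m)"
  unfolding bilinear_conv_bounded_bilinear[symmetric] bilinear_def
  by (auto intro!: linearI simp: matrix_vector_mult_def vec_eq_iff distrib_left distrib_right
      sum.distrib sum_distrib_left mult.assoc mult.left_commute)

interpretation matrix_vector_mult: bounded_bilinear "(*v) :: real^'n^'m \<Rightarrow> real^'n \<Rightarrow> real^'m"
  by (rule bounded_bilinear_matrix_vector_mult)

lemma transpose_add: "transpose (A + B) = transpose A + transpose B"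
  and transpose_minus: "transpose (- C) = - transpose C"
  and transpose_scaleR: "transpose (c *\<^sub>R D) = c *\<^sub>R transpose D"
  by (simp_all add: transpose_def vec_eq_iff)

lemma transpose_diff: "transpose (A - B) = transpose A - transpose B"
  by (simp add: transpose_def vec_eq_iff)

lemma transpose_zero [simp]: "transpose 0 = 0"
  by (simp add: transpose_def vec_eq_iff)

lemma trace_minus: "trace (- A) = - trace A"
  and trace_scaleR: "trace (c *\<^sub>R B) = c * trace B"
  for A B :: "real^'n^'n"
  by (simp_all add: trace_def sum_negf sum_distrib_left)

lemma trace_zero [simp]: "trace 0 = 0"
  by (simp add: trace_def)

lemma trace_transpose: "trace (transpose A) = trace A"
  by (simp add: trace_def transpose_def)

lemma inner_transpose: "(transpose A *v x) \<bullet> y = x \<bullet> (A *v y)" for A :: "real^'n^'m"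
  by (simp add: dot_lmul_matrix)

lemma inner_axis_matrix: "axis i 1 \<bullet> (A *v axis j 1) = A $ i $ j" for A :: "real^'n^'m"
  by (simp add: inner_axis' matrix_vector_mult_basis column_def)

lemma matrix_eq_inner: "A = B \<longleftrightarrow> (\<forall>x y. x \<bullet> (A *v y) = x \<bullet> (B *v y))" for A B :: "real^'n^'m"
  by (metis inner_axis_matrix vec_eq_iff)

definition form_matrix :: "(real^'n \<Rightarrow> real^'n \<Rightarrow> real) \<Rightarrow> real^'n^'n" where
  "form_matrix f = (\<chi> i j. f (axis i 1) (axis j 1))"

lemma inner_form_matrix:
  assumes "bilinear f"
  shows "x \<bullet> (form_matrix f *v y) = f x y"
proof -
  have "f x y = f (\<Sum>i\<in>UNIV. x $ i *\<^sub>R axis i 1) (\<Sum>j\<in>UNIV. y $ j *\<^sub>R axis j 1)"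
    using basis_expansion[of x] basis_expansion[of y] by (simp add: scalar_mult_eq_scaleR)
  also have "\<dots> = (\<Sum>i\<in>UNIV. \<Sum>j\<in>UNIV. x $ i * (y $ j * f (axis i 1) (axis j 1)))"
    unfolding bilinear_sum[OF assms] sum.cartesian_product
    by (intro sum.cong) (auto simp: bilinear_lmul[OF assms] bilinear_rmul[OF assms])
  finally show ?thesis
    by (simp add: form_matrix_def inner_vec_def matrix_vector_mult_def sum_distrib_left mult_ac)
qed

lemma matrix_inv:
  assumes "invertible A"
  shows "A ** matrix_inv A = mat 1" "matrix_inv A ** A = mat 1"
  using someI_ex[OF assms[unfolded invertible_def]] by (auto simp: matrix_inv_def)

lemma matrix_inv_diff:
  fixes A B :: "real^'n^'n"
  assumes "invertible A" "invertible B"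
  shows "matrix_inv A - matrix_inv B = - (matrix_inv A ** (A - B) ** matrix_inv B)"
proof -
  have "matrix_inv A ** (A - B) ** matrix_inv B
      = matrix_inv A ** A ** matrix_inv B - matrix_inv A ** (B ** matrix_inv B)"
    by (simp add: matrix_mult.diff_left matrix_mult.diff_right matrix_mul_assoc)
  then show ?thesis by (simp add: matrix_inv[OF assms(1)] matrix_inv[OF assms(2)])
qed

lemma transpose_matrix_inv:
  fixes A :: "real^'n^'n"
  assumes "invertible A" "transpose A = A"
  shows "transpose (matrix_inv A) = matrix_inv A"
proof -
  have "transpose (matrix_inv A) ** A = mat 1"
    using arg_cong[OF matrix_inv(1)[OF assms(1)], of transpose]
    by (simp add: matrix_transpose_mul assms(2))
  then have "transpose (matrix_inv A) ** (A ** matrix_inv A) = matrix_inv A"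
    by (simp add: matrix_mul_assoc)
  then show ?thesis by (simp add: matrix_inv[OF assms(1)])
qed

text \<open>Let \<open>P\<close> project onto the range of \<open>A\<close>. Then
  \<open>P ** A = A\<close>, while \<open>A ** P = 0\<close> because \<open>A\<close> kills its own
  range; the two products have the same trace.\<close>

lemma trace_eq_0_if_square_eq_0:
  fixes A :: "real^'n^'n"
  assumes "A ** A = 0"
  shows "trace A = 0"
proof -
  have "\<exists>g. g ` UNIV \<subseteq> range ((*v) A) \<and> linear g \<and> (\<forall>v\<in>range ((*v) A). g v = v)"
    by (rule linear_exists_left_inverse_on[of "\<lambda>x. x" "range ((*v) A)"]) (auto intro: linear_subspace_image linear_ident)
  then obtain g where g: "range g \<subseteq> range ((*v) A)" "linear g" "\<And>x. g (A *v x) = A *v x"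
    by auto
  define P where "P = matrix g"
  have P: "P *v x = g x" for x by (simp add: P_def g(2))
  have "P ** A = A" by (simp add: matrix_eq P g(3) flip: matrix_vector_mul_assoc)
  moreover have "A ** P = 0"
  proof -
    have "A *v (g x) = 0" for x
    proof -
      obtain y where "g x = A *v y" using g(1) by blast
      then show ?thesis using assms by (simp add: matrix_vector_mul_assoc)
    qed
    then show ?thesis by (simp add: matrix_eq P flip: matrix_vector_mul_assoc)
  qed
  ultimately show ?thesis by (metis trace_mul_sym trace_zero)
qed

text \<open>Symmetric Gaussian elimination on the set \<open>S\<close> of basis vectors that
  \<open>A\<close> may not kill. Each step subtracts a rank-one matrix; the Schur complement
  \<open>A'\<close> is again semidefinite and kills one more basis vector, and the removed part
  contributes \<open>u \<bullet> (B *v u) / d\<close> to the trace.\<close>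

lemma trace_psd_mult_nonneg_aux:
  fixes A B :: "real^'n^'n"
  assumes "finite S" and B: "\<And>x. 0 \<le> x \<bullet> (B *v x)"
  shows "transpose A = A \<Longrightarrow> (\<And>x. 0 \<le> x \<bullet> (A *v x)) \<Longrightarrow> (\<And>i. i \<notin> S \<Longrightarrow> A *v axis i 1 = 0)
    \<Longrightarrow> 0 \<le> trace (A ** B)"
  using assms(1)
proof (induction S arbitrary: A rule: finite_induct)
  case empty
  have "A = 0"
    using empty(3) by (simp add: vec_eq_iff matrix_vector_mult_basis column_def)
  then show ?case by (simp add: trace_zero)
next
  case (insert i S)
  define u where "u = A *v axis i 1"
  define d where "d = A $ i $ i"
  have sym: "x \<bullet> (A *v y) = y \<bullet> (A *v x)" for x y
    using inner_transpose[of A x y] insert.prems(1) by (simp add: inner_commute)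
  have d: "axis i 1 \<bullet> u = d" by (simp add: u_def d_def inner_axis_matrix)
  have xu: "axis i 1 \<bullet> (A *v x) = x \<bullet> u" for x using sym[of x "axis i 1"] by (simp add: u_def)
  have d0: "0 \<le> d" using insert.prems(2)[of "axis i 1"] by (simp add: d_def inner_axis_matrix)
  \<comment> \<open>The form of \<open>A\<close> at \<open>x + r *\<^sub>R axis i 1\<close>, as a
    quadratic polynomial in \<open>r\<close>.\<close>
  have quad: "0 \<le> x \<bullet> (A *v x) + 2 * r * (x \<bullet> u) + r\<^sup>2 * d" for x r
    using insert.prems(2)[of "x + r *\<^sub>R axis i 1"] xu[of x]
    by (simp add: matrix_vector_mult.add_right matrix_vector_mult.scaleR_right inner_add
        u_def[symmetric] d power2_eq_square algebra_simps)
  show ?case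
  proof (cases "d = 0")
    case True
    have "x \<bullet> u = 0" for x
    proof (rule ccontr)
      assume n: "x \<bullet> u \<noteq> 0"
      show False
        using quad[of x "- (x \<bullet> (A *v x) + 1) / (2 * (x \<bullet> u))"] True n by (simp add: field_simps)
    qed
    then have "u = 0" by (metis inner_eq_zero_iff)
    then show ?thesis
      using insert.prems by (intro insert.IH) (metis u_def insertE)+
  next
    case False
    then have d_pos: "0 < d" using d0 by simp
    define U where "U = (\<chi> i j. u $ i * u $ j)"
    have U: "U *v y = (y \<bullet> u) *\<^sub>R u" for y
      by (simp add: U_def vec_eq_iff matrix_vector_mult_def inner_vec_def sum_distrib_left mult_ac)
    have trU: "trace (U ** B) = u \<bullet> (B *v u)"
    proof -
      have "trace (U ** B) = (\<Sum>k\<in>UNIV. \<Sum>l\<in>UNIV. u $ k * u $ l * B $ l $ k)"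
        by (simp add: U_def trace_def matrix_matrix_mult_def)
      also have "\<dots> = (\<Sum>l\<in>UNIV. \<Sum>k\<in>UNIV. u $ k * u $ l * B $ l $ k)"
        by (rule sum.swap)
      finally show ?thesis
        by (simp add: inner_vec_def matrix_vector_mult_def sum_distrib_left mult_ac)
    qed
    define A' where "A' = A - (1 / d) *\<^sub>R U"
    have A': "A' *v y = A *v y - ((y \<bullet> u) / d) *\<^sub>R u" for y
      by (simp add: A'_def matrix_vector_mult.diff_left matrix_vector_mult.scaleR_left U)
    have "0 \<le> trace (A' ** B)"
    proof (rule insert.IH)
      show "transpose A' = A'"
        using insert.prems(1) by (simp add: A'_def transpose_diff transpose_scaleR)
          (simp add: U_def transpose_def vec_eq_iff mult.commute)
      \<comment> \<open>The chosen \<open>r\<close> minimises the polynomial, and the minimum is the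
        form of the Schur complement.\<close>
      show "0 \<le> x \<bullet> (A' *v x)" for x
        using quad[of x "- (x \<bullet> u) / d"] d_pos
        by (simp add: A' inner_diff_right power2_eq_square field_simps)
      show "A' *v axis j 1 = 0" if "j \<notin> S" for j
      proof (cases "j = i")
        case True
        then show ?thesis using d False by (simp add: A' flip: u_def)
      next
        case False
        then have "A *v axis j 1 = 0" using insert.prems(3) that by auto
        then show ?thesis using xu[of "axis j 1"] by (simp add: A')
      qed
    qed
    moreover have "trace (A ** B) = trace (A' ** B) + (1 / d) * trace (U ** B)"
      by (simp add: A'_def matrix_mult.diff_left matrix_mult.scaleR_left trace_sub trace_scaleR)
    ultimately show ?thesis using trU B[of u] d_pos by simp
  qed
qed

lemma trace_psd_mult_nonneg:
  fixes A B :: "real^'n^'n"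
  assumes "transpose A = A" "\<And>x. 0 \<le> x \<bullet> (A *v x)" "\<And>x. 0 \<le> x \<bullet> (B *v x)"
  shows "0 \<le> trace (A ** B)"
  by (rule trace_psd_mult_nonneg_aux[of UNIV]) (use assms in auto)

lemma psd_conjugate:
  fixes A :: "real^'n^'n" and N :: "real^'m^'n"
  assumes "\<And>x. 0 \<le> x \<bullet> (A *v x)"
  shows "0 \<le> x \<bullet> ((transpose N ** A ** N) *v x)"
  using assms[of "N *v x"] inner_transpose[of N "A *v (N *v x)" x]
  by (simp add: inner_commute flip: matrix_vector_mul_assoc)

section \<open>Positive definite matrices and Lipschitz control of their inverses\<close>

lemma inner_product_matrix_invertible:
  assumes "inner_product_matrix G"
  shows "invertible G"
  unfolding invertible_left_inverse matrix_left_invertible_ker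
proof (intro allI impI)
  fix x assume "G *v x = 0"
  then have "\<not> 0 < ip G x x" by (simp add: ip_def)
  then show "x = 0" using assms by (auto simp: inner_product_matrix_def)
qed

lemma inner_product_matrix_inv:
  assumes "inner_product_matrix G"
  shows "inner_product_matrix (matrix_inv G)"
proof -
  note inv = inner_product_matrix_invertible[OF assms]
  have "0 < ip (matrix_inv G) x x" if "x \<noteq> 0" for x
  proof -
    define y where "y = matrix_inv G *v x"
    have x: "x = G *v y" by (simp add: y_def matrix_vector_mul_assoc matrix_inv[OF inv])
    then have "y \<noteq> 0" using that by auto
    then show ?thesis using assms
      by (simp add: ip_def inner_product_matrix_def x matrix_vector_mul_assoc matrix_inv[OF inv])
        (metis inner_commute)
  qed
  then show ?thesis
    using assms transpose_matrix_inv[OF inv] by (simp add: inner_product_matrix_def)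
qed

text \<open>The constant is the minimum of the form on the compact unit sphere, carried to all
  vectors by homogeneity.\<close>

lemma inner_product_matrix_coercive:
  fixes G :: "real^'n^'n"
  assumes "inner_product_matrix G"
  shows "\<exists>c>0. \<forall>x. c * (norm x)\<^sup>2 \<le> x \<bullet> (G *v x)"
proof -
  have "continuous_on (sphere 0 1) (\<lambda>x. x \<bullet> (G *v x))"
    by (intro continuous_intros)
  moreover have "sphere (0 :: real^'n) 1 \<noteq> {}" using norm_axis_1 by force
  ultimately obtain z where z: "norm z = 1" "\<And>x. norm x = 1 \<Longrightarrow> z \<bullet> (G *v z) \<le> x \<bullet> (G *v x)"
    using continuous_attains_inf[of "sphere 0 1" "\<lambda>x. x \<bullet> (G *v x)"] by (auto simp: compact_sphere)
  show ?thesis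
  proof (intro exI[of _ "z \<bullet> (G *v z)"] conjI allI)
    show "0 < z \<bullet> (G *v z)" using z(1) assms by (metis inner_product_matrix_def ip_def norm_zero zero_neq_one)
    fix x :: "real^'n"
    show "z \<bullet> (G *v z) * (norm x)\<^sup>2 \<le> x \<bullet> (G *v x)"
    proof (cases "x = 0")
      case False
      then have "z \<bullet> (G *v z) \<le> (x /\<^sub>R norm x) \<bullet> (G *v (x /\<^sub>R norm x))" by (intro z(2)) simp
      also have "\<dots> = x \<bullet> (G *v x) / (norm x)\<^sup>2"
        by (simp add: matrix_vector_mult.scaleR_right power2_eq_square divide_inverse)
      finally show ?thesis using False by (simp add: field_simps)
    qed simp
  qed
qed

text \<open>Cauchy-Schwarz turns coercivity into \<open>c * norm x \<le> norm (H *v x)\<close>.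
  Hence every column of the inverse has norm at most \<open>1 / c\<close>; crude summation over
  columns and rows gives the two dimension factors.\<close>

lemma coercive_invertible:
  fixes H :: "real^'n^'n"
  assumes "c > 0" "\<And>x. c * (norm x)\<^sup>2 \<le> x \<bullet> (H *v x)"
  shows "invertible H" "norm (matrix_inv H) \<le> real CARD('n) * (real CARD('n) / c)"
proof -
  have *: "c * norm x \<le> norm (H *v x)" for x
  proof (cases "x = 0")
    case False
    have "c * (norm x)\<^sup>2 \<le> norm x * norm (H *v x)"
      using assms(2)[of x] Cauchy_Schwarz_ineq2[of x "H *v x"] by linarith
    then show ?thesis using False by (simp add: power2_eq_square mult_ac)
  qed simp
  then show inv: "invertible H"
    unfolding invertible_left_inverse matrix_left_invertible_ker
    using assms(1) by (metis mult_pos_pos not_less norm_zero zero_less_norm_iff)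
  have "\<bar>matrix_inv H $ i $ j\<bar> \<le> 1 / c" for i j
  proof -
    have "c * norm (matrix_inv H *v axis j 1) \<le> norm (H *v (matrix_inv H *v axis j 1))"
      by (rule *)
    also have "\<dots> = 1" by (simp add: matrix_vector_mul_assoc matrix_inv[OF inv])
    finally have "norm (matrix_inv H *v axis j 1) \<le> 1 / c" using assms(1) by (simp add: field_simps)
    then show ?thesis
      by (metis component_le_norm_cart order_trans inner_axis_matrix inner_axis' mult_1 inner_real_def)
  qed
  then have "norm (matrix_inv H $ i) \<le> real CARD('n) / c" for i
    using sum_bounded_above[of UNIV "\<lambda>j. \<bar>matrix_inv H $ i $ j\<bar>" "1 / c"]
      norm_le_l1_cart[of "matrix_inv H $ i"] by simp
  then show "norm (matrix_inv H) \<le> real CARD('n) * (real CARD('n) / c)"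
    using sum_bounded_above[of UNIV "\<lambda>i. norm (matrix_inv H $ i)" "real CARD('n) / c"]
      L2_set_le_sum[of UNIV "\<lambda>i. norm (matrix_inv H $ i)"] by (simp add: norm_vec_def)
qed

text \<open>A bilinear map is in general Lipschitz only on bounded sets, whence the bounds on both
  images. The difference is split by changing one factor at a time.\<close>

lemma lipschitz_on_bilinear:
  assumes B: "bounded_bilinear B"
    and f: "\<exists>L. L-lipschitz_on S f" "bounded (f ` S)"
    and g: "\<exists>L. L-lipschitz_on S g" "bounded (g ` S)"
  shows "\<exists>L. L-lipschitz_on S (\<lambda>x. B (f x) (g x))" "bounded ((\<lambda>x. B (f x) (g x)) ` S)"
proof -
  interpret bounded_bilinear B by fact
  obtain K where K: "K \<ge> 0" "\<And>a b. norm (B a b) \<le> norm a * norm b * K"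
    using nonneg_bounded by auto
  obtain Lf Lg where L: "Lf-lipschitz_on S f" "Lg-lipschitz_on S g" using f g by auto
  obtain Mf where Mf: "Mf > 0" "\<And>x. x \<in> S \<Longrightarrow> norm (f x) \<le> Mf" using f(2) by (auto simp: bounded_pos)
  obtain Mg where Mg: "Mg > 0" "\<And>x. x \<in> S \<Longrightarrow> norm (g x) \<le> Mg" using g(2) by (auto simp: bounded_pos)
  note L0 = L[THEN lipschitz_on_nonneg]
  show "bounded ((\<lambda>x. B (f x) (g x)) ` S)"
    unfolding bounded_iff
  proof (intro exI[of _ "Mf * Mg * K"] ballI)
    fix y assume "y \<in> (\<lambda>x. B (f x) (g x)) ` S"
    then obtain x where x: "x \<in> S" "y = B (f x) (g x)" by auto
    have "norm (f x) * norm (g x) * K \<le> Mf * Mg * K"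
      using Mf(2)[OF x(1)] Mg(2)[OF x(1)] K(1) Mf(1) by (intro mult_right_mono mult_mono) auto
    then show "norm y \<le> Mf * Mg * K" using K(2)[of "f x" "g x"] x by simp
  qed
  have "(Lf * Mg * K + Mf * Lg * K)-lipschitz_on S (\<lambda>x. B (f x) (g x))"
  proof (rule lipschitz_onI)
    fix x y assume xy: "x \<in> S" "y \<in> S"
    have "B (f x) (g x) - B (f y) (g y) = B (f x - f y) (g x) + B (f y) (g x - g y)"
      by (simp add: diff_left diff_right)
    then have "dist (B (f x) (g x)) (B (f y) (g y))
        \<le> norm (f x - f y) * norm (g x) * K + norm (f y) * norm (g x - g y) * K"
      unfolding dist_norm using norm_triangle_mono[OF K(2) K(2)] by metis
    also have "\<dots> \<le> (Lf * dist x y) * Mg * K + Mf * (Lg * dist x y) * K"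
      using lipschitz_onD[OF L(1) xy] lipschitz_onD[OF L(2) xy] Mf Mg xy K(1) L0
      by (intro add_mono mult_right_mono mult_mono) (auto simp: dist_norm)
    finally show "dist (B (f x) (g x)) (B (f y) (g y)) \<le> (Lf * Mg * K + Mf * Lg * K) * dist x y"
      by (simp add: algebra_simps)
  qed (use L0 K Mf Mg in auto)
  then show "\<exists>L. L-lipschitz_on S (\<lambda>x. B (f x) (g x))" by blast
qed

text \<open>A common coercivity constant bounds all inverses at once, and the resolvent identity
  \<open>matrix_inv_diff\<close> then bounds their differences. Each of its two matrix products
  costs one factor \<open>K\<close>.\<close>

lemma matrix_inv_lipschitz:
  fixes S :: "(real^'n^'n) set"
  assumes "c > 0" "\<And>H x. H \<in> S \<Longrightarrow> c * (norm x)\<^sup>2 \<le> x \<bullet> (H *v x)"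
  shows "\<exists>L. L-lipschitz_on S matrix_inv" "bounded (matrix_inv ` S)"
proof -
  define b where "b = real CARD('n) * (real CARD('n) / c)"
  have b: "norm (matrix_inv H) \<le> b" "invertible H" if "H \<in> S" for H
    using coercive_invertible[OF assms(1) assms(2)[OF that]] by (auto simp: b_def)
  show "bounded (matrix_inv ` S)" using b by (auto simp: bounded_iff)
  obtain K where K: "K \<ge> 0" "\<And>(A :: real^'n^'n) (B :: real^'n^'n). norm (A ** B) \<le> norm A * norm B * K"
    using matrix_mult.nonneg_bounded by auto
  have b0: "b \<ge> 0" using assms(1) by (simp add: b_def)
  have "(b * K * (b * K))-lipschitz_on S matrix_inv"
  proof (rule lipschitz_onI)
    fix A B assume AB: "A \<in> S" "B \<in> S"
    have "norm (matrix_inv A ** (A - B) ** matrix_inv B)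
      \<le> norm (matrix_inv A ** (A - B)) * norm (matrix_inv B) * K" by (rule K)
    also have "\<dots> \<le> (b * norm (A - B) * K) * b * K"
      using b[OF AB(1)] b[OF AB(2)] K(1) K(2)[of "matrix_inv A" "A - B"] b0
      by (intro mult_right_mono mult_mono order_trans[OF K(2)]) auto
    finally show "dist (matrix_inv A) (matrix_inv B) \<le> b * K * (b * K) * dist A B"
      unfolding dist_norm matrix_inv_diff[OF b(2)[OF AB(1)] b(2)[OF AB(2)]] norm_minus_cancel
      by (simp add: mult_ac)
  qed (use K b0 in auto)
  then show "\<exists>L. L-lipschitz_on S matrix_inv" by blast
qed

section \<open>Differentiating the inverse of a curve of matrices\<close>

lemma has_vector_derivative_iff_tendsto:
  "(f has_vector_derivative D) (at t within S) \<longleftrightarrow>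
    ((\<lambda>s. (f s - f t) /\<^sub>R (s - t)) \<longlongrightarrow> D) (at t within S)"
proof -
  have "norm ((f s - f t) - (s - t) *\<^sub>R D) / norm (s - t) = norm ((f s - f t) /\<^sub>R (s - t) - D)"
    if "s \<noteq> t" for s
  proof -
    have "(f s - f t) /\<^sub>R (s - t) - D = ((f s - f t) - (s - t) *\<^sub>R D) /\<^sub>R (s - t)"
      using that by (simp add: scaleR_diff_right)
    then show ?thesis by (simp add: divide_inverse)
  qed
  then have "eventually (\<lambda>s. norm ((f s - f t) - (s - t) *\<^sub>R D) / norm (s - t)
      = norm ((f s - f t) /\<^sub>R (s - t) - D)) (at t within S)"
    by (simp add: eventually_at_filter)
  from tendsto_cong[OF this] show ?thesis
    unfolding has_vector_derivative_def has_derivative_iff_norm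
    by (simp add: bounded_linear_scaleR_left tendsto_norm_zero_iff LIM_zero_iff)
qed

text \<open>By the resolvent identity, the difference quotient of the inverse is, up to sign, that
  of \<open>P\<close> placed between two inverses. For the flow, continuity of the inverse comes
  from \<open>matrix_inv_lipschitz\<close>.\<close>

lemma has_vector_derivative_matrix_inv:
  fixes P :: "real \<Rightarrow> real^'n^'n"
  assumes P: "(P has_vector_derivative P') (at t within S)" and t: "t \<in> S"
    and inv: "\<And>s. s \<in> S \<Longrightarrow> invertible (P s)"
    and cont: "continuous_on S (\<lambda>s. matrix_inv (P s))"
  shows "((\<lambda>s. matrix_inv (P s)) has_vector_derivative
    - (matrix_inv (P t) ** P' ** matrix_inv (P t))) (at t within S)"
proof -
  have "((\<lambda>s. (P s - P t) /\<^sub>R (s - t)) \<longlongrightarrow> P') (at t within S)"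
    using P by (simp add: has_vector_derivative_iff_tendsto)
  moreover have "((\<lambda>s. matrix_inv (P s)) \<longlongrightarrow> matrix_inv (P t)) (at t within S)"
    using cont t by (simp add: continuous_on)
  ultimately have "((\<lambda>s. - (matrix_inv (P s) ** ((P s - P t) /\<^sub>R (s - t)) ** matrix_inv (P t)))
      \<longlongrightarrow> - (matrix_inv (P t) ** P' ** matrix_inv (P t))) (at t within S)"
    by (intro tendsto_intros matrix_mult.tendsto)
  moreover have "eventually (\<lambda>s. - (matrix_inv (P s) ** ((P s - P t) /\<^sub>R (s - t)) ** matrix_inv (P t))
      = (matrix_inv (P s) - matrix_inv (P t)) /\<^sub>R (s - t)) (at t within S)"
    unfolding eventually_at_filter
  proof (intro always_eventually allI impI)
    fix s assume "s \<noteq> t" "s \<in> S"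
    show "- (matrix_inv (P s) ** ((P s - P t) /\<^sub>R (s - t)) ** matrix_inv (P t))
      = (matrix_inv (P s) - matrix_inv (P t)) /\<^sub>R (s - t)"
      unfolding matrix_inv_diff[OF inv[OF \<open>s \<in> S\<close>] inv[OF t]]
      by (simp only: matrix_mult.scaleR_left matrix_mult.scaleR_right scaleR_minus_right)
  qed
  ultimately show ?thesis
    unfolding has_vector_derivative_iff_tendsto by (rule Lim_transform_eventually)
qed

lemma bounded_bilinear_linear_compose:
  fixes B :: "'a::euclidean_space \<Rightarrow> 'b::euclidean_space \<Rightarrow> 'c::real_normed_vector"
  assumes "linear T" "bounded_bilinear B"
  shows "bounded_bilinear (\<lambda>x y. T (B x y))"
  using assms unfolding bilinear_conv_bounded_bilinear[symmetric] bilinear_def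
  by (auto intro: linear_compose[unfolded o_def])

lemma continuous_on_transpose [continuous_intros]:
  fixes f :: "'a::topological_space \<Rightarrow> real^'n^'m"
  assumes "continuous_on S f"
  shows "continuous_on S (\<lambda>x. transpose (f x))"
  unfolding transpose_def by (intro continuous_intros assms)

section \<open>The Ricci form of a two-step nilpotent Lie algebra\<close>

locale two_step_algebra =
  fixes mu :: "real^'n \<Rightarrow> real^'n \<Rightarrow> real^'n"
  assumes bilinear_mu: "bilinear mu"
    and skew_mu: "mu x y = - mu y x"
    and mu_mu_left: "mu (mu x y) z = 0"
begin

lemma mu_mu_right: "mu z (mu x y) = 0"
  using skew_mu[of z "mu x y"] mu_mu_left by simp

section \<open>Adjoint operators and the two-forms dual to the bracket\<close>

definition ad :: "real^'n \<Rightarrow> real^'n^'n" where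
  "ad x = matrix (mu x)"

lemma ad_mult [simp]: "ad x *v y = mu x y"
  using bilinear_mu by (simp add: ad_def bilinear_def)

lemma ad_add: "ad (x + y) = ad x + ad y"
  and ad_scaleR: "ad (c *\<^sub>R x) = c *\<^sub>R ad x"
  by (simp_all add: matrix_eq matrix_vector_mult.add_left matrix_vector_mult.scaleR_left
      bilinear_ladd[OF bilinear_mu] bilinear_lmul[OF bilinear_mu])

lemma ad_mult_ad: "ad x ** ad y = 0"
  by (simp add: matrix_eq mu_mu_right flip: matrix_vector_mul_assoc)

text \<open>Here \<open>a\<close> is a covector in coordinates. For \<open>a = G *v z\<close> this
  is the two-form g(z,[.,.]), up to sign the exterior derivative of the one-form dual to
  \<open>z\<close>.\<close>

definition omega :: "real^'n \<Rightarrow> real^'n^'n" where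
  "omega a = form_matrix (\<lambda>x y. a \<bullet> mu x y)"

lemma inner_omega: "x \<bullet> (omega a *v y) = a \<bullet> mu x y"
  unfolding omega_def
  by (rule inner_form_matrix)
     (auto intro!: linearI simp: bilinear_def bilinear_ladd[OF bilinear_mu] bilinear_lmul[OF bilinear_mu]
       bilinear_radd[OF bilinear_mu] bilinear_rmul[OF bilinear_mu] inner_add)

lemma omega_add: "omega (x + y) = omega x + omega y"
  and omega_scaleR: "omega (c *\<^sub>R x) = c *\<^sub>R omega x"
  by (simp_all add: matrix_eq_inner inner_omega matrix_vector_mult.add_left
      matrix_vector_mult.scaleR_left inner_add)

lemma transpose_omega: "transpose (omega a) = - omega a"
proof -
  have "x \<bullet> (transpose (omega a) *v y) = x \<bullet> (- omega a *v y)" for x y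
    using inner_transpose[of "omega a" y x] skew_mu[of x y]
    by (simp add: inner_omega matrix_vector_mult.minus_left inner_commute)
  then show ?thesis by (simp add: matrix_eq_inner)
qed

text \<open>With \<open>A = matrix_inv G\<close> and \<open>C = G\<close> this is the metric inner
  product of \<open>ad x\<close> and \<open>ad y\<close>. \<open>ric_up\<close> with
  \<open>matrix_inv G\<close> in both slots is the inner product of the two-forms
  \<open>omega x\<close> and \<open>omega y\<close>, so its arguments are covectors. Separate slots
  make both maps bilinear and let the flow insert different inverses.\<close>

definition ric_down :: "real^'n^'n \<Rightarrow> real^'n^'n \<Rightarrow> real^'n^'n" where
  "ric_down A C = form_matrix (\<lambda>x y. trace (A ** transpose (ad x) ** C ** ad y))"

definition ric_up :: "real^'n^'n \<Rightarrow> real^'n^'n \<Rightarrow> real^'n^'n" where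
  "ric_up A C = form_matrix (\<lambda>x y. trace (A ** omega x ** C ** transpose (omega y)))"

lemma inner_ric_down: "x \<bullet> (ric_down A C *v y) = trace (A ** transpose (ad x) ** C ** ad y)"
  unfolding ric_down_def
  by (rule inner_form_matrix)
     (auto intro!: linearI simp: bilinear_def ad_add ad_scaleR transpose_add transpose_scaleR
       matrix_mult.add_left matrix_mult.add_right matrix_mult.scaleR_left matrix_mult.scaleR_right
       trace_add trace_scaleR)

lemma inner_ric_up: "x \<bullet> (ric_up A C *v y) = trace (A ** omega x ** C ** transpose (omega y))"
  unfolding ric_up_def
  by (rule inner_form_matrix)
     (auto intro!: linearI simp: bilinear_def omega_add omega_scaleR transpose_add transpose_scaleR
       matrix_mult.add_left matrix_mult.add_right matrix_mult.scaleR_left matrix_mult.scaleR_right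
       trace_add trace_scaleR)

lemma bounded_bilinear_ric_down: "bounded_bilinear ric_down"
  unfolding bilinear_conv_bounded_bilinear[symmetric] bilinear_def
  by (auto intro!: linearI simp: matrix_eq_inner inner_ric_down matrix_vector_mult.add_left
      matrix_vector_mult.scaleR_left inner_add matrix_mult.add_left matrix_mult.add_right
      matrix_mult.scaleR_left matrix_mult.scaleR_right trace_add trace_scaleR)

lemma bounded_bilinear_ric_up: "bounded_bilinear ric_up"
  unfolding bilinear_conv_bounded_bilinear[symmetric] bilinear_def
  by (auto intro!: linearI simp: matrix_eq_inner inner_ric_up matrix_vector_mult.add_left
      matrix_vector_mult.scaleR_left inner_add matrix_mult.add_left matrix_mult.add_right
      matrix_mult.scaleR_left matrix_mult.scaleR_right trace_add trace_scaleR)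

lemma transpose_ric_down:
  assumes "transpose A = A" "transpose C = C"
  shows "transpose (ric_down A C) = ric_down A C"
proof -
  have "x \<bullet> (transpose (ric_down A C) *v y) = x \<bullet> (ric_down A C *v y)" for x y
  proof -
    have "x \<bullet> (transpose (ric_down A C) *v y) = trace (A ** transpose (ad y) ** C ** ad x)"
      using inner_transpose[of "ric_down A C" y x] by (simp add: inner_ric_down inner_commute)
    also have "\<dots> = trace (transpose (A ** transpose (ad y) ** C ** ad x))"
      by (simp add: trace_transpose)
    also have "transpose (A ** transpose (ad y) ** C ** ad x) = (transpose (ad x) ** C ** ad y) ** A"
      by (simp add: matrix_transpose_mul assms matrix_mul_assoc)
    also have "trace \<dots> = trace (A ** transpose (ad x) ** C ** ad y)"
      by (subst trace_mul_sym) (simp add: matrix_mul_assoc)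
    finally show ?thesis by (simp add: inner_ric_down)
  qed
  then show ?thesis by (simp add: matrix_eq_inner)
qed

lemma transpose_ric_up:
  assumes "transpose A = A"
  shows "transpose (ric_up A A) = ric_up A A"
proof -
  have "x \<bullet> (transpose (ric_up A A) *v y) = x \<bullet> (ric_up A A *v y)" for x y
  proof -
    have "x \<bullet> (transpose (ric_up A A) *v y) = trace (A ** omega y ** A ** transpose (omega x))"
      using inner_transpose[of "ric_up A A" y x] by (simp add: inner_ric_up inner_commute)
    also have "\<dots> = trace (transpose (A ** omega y ** A ** transpose (omega x)))"
      by (simp add: trace_transpose)
    also have "transpose (A ** omega y ** A ** transpose (omega x)) = (omega x ** A ** transpose (omega y)) ** A"
      by (simp add: matrix_transpose_mul assms matrix_mul_assoc)
    also have "trace \<dots> = trace (A ** omega x ** A ** transpose (omega y))"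
      by (subst trace_mul_sym) (simp add: matrix_mul_assoc)
    finally show ?thesis by (simp add: inner_ric_up)
  qed
  then show ?thesis by (simp add: matrix_eq_inner)
qed

text \<open>The diagonal value is the trace of \<open>A\<close> times
  \<open>transpose (ad x) ** C ** ad x\<close>, both semidefinite.\<close>

lemma ric_down_psd:
  assumes "transpose A = A" "\<And>x. 0 \<le> x \<bullet> (A *v x)" "\<And>x. 0 \<le> x \<bullet> (C *v x)"
  shows "0 \<le> x \<bullet> (ric_down A C *v x)"
  using trace_psd_mult_nonneg[OF assms(1,2) psd_conjugate[OF assms(3), of _ "ad x"]]
  by (simp add: inner_ric_down matrix_mul_assoc)

lemma ric_up_psd:
  assumes "transpose A = A" "\<And>x. 0 \<le> x \<bullet> (A *v x)"
  shows "0 \<le> x \<bullet> (ric_up A A *v x)"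
  using trace_psd_mult_nonneg[OF assms(1,2) psd_conjugate[OF assms(2), of _ "transpose (omega x)"]]
  by (simp add: inner_ric_up matrix_mul_assoc)

text \<open>With \<open>T x = G\<inverse> (ad x)\<^sup>T G\<close> the metric adjoint of \<open>ad x\<close> and \<open>S y z = T z y\<close>, the Koszul
  formula reads \<open>\<nabla>\<^sub>x y = (ad x y - T y x - T x y) / 2\<close>.\<close>

lemma LC_eq:
  assumes sym: "transpose G = G" and inv: "invertible G"
    and T: "\<And>x. T x = matrix_inv G ** transpose (ad x) ** G"
    and S: "\<And>x. S x = - (matrix_inv G ** omega (G *v x))"
  shows "LC G mu x y = (1/2) *\<^sub>R ((ad x - S x - T x) *v y)"
    and "LC G mu x y = - (1/2) *\<^sub>R ((ad y + T y + S y) *v x)"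
proof -
  have symG: "v \<bullet> (G *v w) = w \<bullet> (G *v v)" for v w
    using inner_transpose[of G v w] by (simp add: sym inner_commute)
  have ST: "S v *v w = T w *v v" for v w
  proof -
    have "u \<bullet> (transpose (ad w) *v (G *v v)) = u \<bullet> (- omega (G *v v) *v w)" for u
      using inner_transpose[of "ad w" "G *v v" u] skew_mu[of u w]
      by (simp add: inner_omega inner_commute matrix_vector_mult.minus_left)
    then have "transpose (ad w) *v (G *v v) = - omega (G *v v) *v w" using vector_eq_ldot by blast
    then show ?thesis
      by (simp add: S T matrix_vector_mult.minus_left matrix_vector_mult.minus_right
          flip: matrix_vector_mul_assoc)
  qed
  have "(\<chi> k. (ip G (mu x y) (axis k 1) - ip G (mu y (axis k 1)) x + ip G (mu (axis k 1) x) y) / 2)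
      = (1/2) *\<^sub>R (G *v mu x y - transpose (ad y) *v (G *v x) - transpose (ad x) *v (G *v y))"
    (is "?l = ?r")
  proof -
    have "?l $ k = ?r $ k" for k
    proof -
      have "ip G (mu (axis k 1) x) y = - ip G (mu x (axis k 1)) y"
        using skew_mu[of "axis k 1" x] by (simp add: ip_def)
      moreover have "ip G (mu v (axis k 1)) w = (transpose (ad v) *v (G *v w)) $ k" for v w
        using inner_transpose[of "ad v" "G *v w" "axis k 1"]
        by (simp add: ip_def inner_commute inner_axis' del: transpose_matrix_vector)
      moreover have "ip G (mu x y) (axis k 1) = (G *v mu x y) $ k"
        using symG[of "mu x y" "axis k 1"] by (simp add: ip_def inner_axis')
      ultimately show ?thesis by simp
    qed
    then show ?thesis by (simp add: vec_eq_iff)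
  qed
  then have "LC G mu x y = (1/2) *\<^sub>R (mu x y - T y *v x - T x *v y)"
    unfolding LC_def
    by (simp add: T matrix_vector_mult.scaleR_right matrix_vector_mult.diff_right
        matrix_vector_mul_assoc matrix_mul_assoc matrix_inv[OF inv])
  \<comment> \<open>This second form isolates \<open>x\<close> as the vector acted on, since Ricci
    is a trace over the direction of differentiation.\<close>
  moreover from this have "LC G mu x y = (1/2) *\<^sub>R (- mu y x - T y *v x - S y *v x)"
    using skew_mu[of x y] ST[of y x] by simp
  ultimately show "LC G mu x y = (1/2) *\<^sub>R ((ad x - S x - T x) *v y)"
    and "LC G mu x y = - (1/2) *\<^sub>R ((ad y + T y + S y) *v x)"
    using ST[of x y]
    by (simp_all add: matrix_vector_mult.add_left matrix_vector_mult.diff_left algebra_simps)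
qed

text \<open>Ricci is the trace of the curvature in its first argument, here written as a matrix. The
  operators \<open>ad\<close>, \<open>S\<close>, \<open>T\<close> are traceless, and nilpotency
  kills the products \<open>ad ad\<close>, \<open>S ad\<close>, \<open>T S\<close> and
  \<open>T T\<close>, so only two traces survive.\<close>

lemma ricci_eq_trace:
  assumes sym: "transpose G = G" and inv: "invertible G"
    and T: "\<And>x. T x = matrix_inv G ** transpose (ad x) ** G"
    and S: "\<And>x. S x = - (matrix_inv G ** omega (G *v x))"
  shows "ricci G mu x y = - (1/4) * trace (S x ** S y) - (1/2) * trace (T x ** ad y)"
proof -
  define Gi where "Gi = matrix_inv G"
  note Gi = matrix_inv[OF inv, folded Gi_def]
  note LC = LC_eq[OF assms]
  have symGi: "transpose Gi = Gi"
    unfolding Gi_def by (rule transpose_matrix_inv[OF inv sym])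
  define U where "U = LC G mu x y"
  \<comment> \<open>\<open>D v *v z\<close> is -2 times the covariant derivative of \<open>v\<close>
    along \<open>z\<close>, and \<open>E *v z\<close> is twice that of \<open>z\<close> along
    \<open>x\<close>.\<close>
  define D where "D v = ad v + T v + S v" for v
  define E where "E = ad x - S x - T x"
  have "curv G mu z x y = (- (1/2) *\<^sub>R D U + (1/4) *\<^sub>R (E ** D y) - (1/2) *\<^sub>R (D y ** ad x)) *v z" for z
  proof -
    have "LC G mu (mu z x) y = (1/2) *\<^sub>R (D y *v (ad x *v z))"
      using skew_mu[of z x] by (simp add: LC(2) D_def matrix_vector_mult.minus_right)
    moreover have "LC G mu x (LC G mu z y) = - (1/4) *\<^sub>R (E *v (D y *v z))"
      by (simp add: LC(1)[of x] LC(2)[of z] D_def E_def matrix_vector_mult.scaleR_right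
          matrix_vector_mult.minus_right)
    moreover have "LC G mu z U = - (1/2) *\<^sub>R (D U *v z)" by (simp add: LC(2) D_def)
    ultimately show ?thesis
      by (simp add: curv_def U_def matrix_vector_mult.add_left matrix_vector_mult.diff_left
          matrix_vector_mult.scaleR_left matrix_vector_mult.minus_left del: ad_mult
          flip: matrix_vector_mul_assoc)
  qed
  then have ric: "ricci G mu x y = - (1/2) * trace (D U) + (1/4) * trace (E ** D y)
      - (1/2) * trace (D y ** ad x)"
    by (simp add: ricci_def matrix_vector_mult_basis column_def trace_def sum.distrib sum_subtractf
        sum_negf flip: sum_divide_distrib)
  have tr_ad: "trace (ad v) = 0" for v
    by (rule trace_eq_0_if_square_eq_0) (rule ad_mult_ad)
  have tr_T: "trace (T v) = 0" for v
  proof -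
    have "trace (T v) = trace (G ** (Gi ** transpose (ad v)))"
      unfolding T Gi_def by (rule trace_mul_sym)
    then show ?thesis by (simp add: matrix_mul_assoc Gi trace_transpose tr_ad)
  qed
  \<comment> \<open>A symmetric matrix times a skew one: transposing shows that the trace is its own
    negative.\<close>
  have tr_S: "trace (S v) = 0" for v
  proof -
    have "trace (S v) = trace (transpose (- (Gi ** omega (G *v v))))"
      by (simp add: S Gi_def trace_transpose)
    also have "\<dots> = trace (omega (G *v v) ** Gi)"
      by (simp add: matrix_transpose_mul transpose_minus transpose_omega symGi
          matrix_mult.minus_left)
    also have "\<dots> = - trace (S v)"
      by (subst trace_mul_sym) (simp add: S Gi_def trace_minus)
    finally show ?thesis by simp
  qed
  \<comment> \<open>Brackets are central, so they lie in the kernel of every \<open>omega a\<close>.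
    The vanishing products below reduce to this or to \<open>ad_mult_ad\<close>.\<close>
  have omega_ad: "omega a ** ad v = 0" and ad_omega: "transpose (ad v) ** omega a = 0" for a v
  proof -
    show "omega a ** ad v = 0"
      by (simp add: matrix_eq_inner inner_omega mu_mu_right flip: matrix_vector_mul_assoc)
    then have "transpose (omega a ** ad v) = transpose 0" by simp
    then show "transpose (ad v) ** omega a = 0"
      by (simp add: matrix_transpose_mul transpose_omega matrix_mult.minus_right)
  qed
  have S_ad: "S v ** ad w = 0" for v w
    by (simp add: S matrix_mult.minus_left omega_ad flip: matrix_mul_assoc)
  have T_S: "T v ** S w = 0" for v w
  proof -
    have "T v ** S w = - (Gi ** transpose (ad v) ** (G ** Gi) ** omega (G *v w))"
      by (simp add: T S Gi_def matrix_mult.minus_right matrix_mul_assoc)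
    also have "\<dots> = - (Gi ** (transpose (ad v) ** omega (G *v w)))"
      by (simp add: Gi matrix_mul_assoc)
    finally show ?thesis by (simp add: ad_omega)
  qed
  have T_T: "T v ** T w = 0" for v w
  proof -
    have "T v ** T w = Gi ** transpose (ad v) ** (G ** Gi) ** transpose (ad w) ** G"
      by (simp add: T Gi_def matrix_mul_assoc)
    also have "\<dots> = Gi ** transpose (ad w ** ad v) ** G"
      by (simp add: Gi matrix_mul_assoc matrix_transpose_mul)
    finally show ?thesis by (simp add: ad_mult_ad)
  qed
  have ad_T: "trace (ad v ** T w) = trace (T v ** ad w)" for v w
  proof -
    have "trace (ad v ** T w) = trace (transpose (ad v ** Gi ** transpose (ad w) ** G))"
      by (simp add: T Gi_def matrix_mul_assoc trace_transpose)
    also have "transpose (ad v ** Gi ** transpose (ad w) ** G) = (G ** ad w) ** (Gi ** transpose (ad v))"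
      by (simp add: matrix_transpose_mul sym symGi matrix_mul_assoc)
    also have "trace \<dots> = trace (T v ** ad w)"
      by (subst trace_mul_sym) (simp add: T Gi_def matrix_mul_assoc)
    finally show ?thesis .
  qed
  have "trace (D U) = 0" by (simp add: D_def trace_add tr_ad tr_S tr_T)
  \<comment> \<open>The terms \<open>ad x ** T y\<close> and \<open>T x ** ad y\<close> have equal
    traces and opposite signs; the remaining mixed terms vanish, two of them after a cyclic
    shift.\<close>
  moreover have "trace (E ** D y) = - trace (S x ** S y)"
    using trace_mul_sym[of "ad x" "S y"] trace_mul_sym[of "S x" "T y"] ad_T[of x y]
    by (simp add: D_def E_def matrix_mult.add_right matrix_mult.diff_left trace_add trace_sub
        ad_mult_ad S_ad T_S T_T)
  moreover have "trace (D y ** ad x) = trace (T x ** ad y)"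
    using trace_mul_sym[of "T y" "ad x"] ad_T[of x y]
    by (simp add: D_def matrix_mult.add_left trace_add ad_mult_ad S_ad)
  ultimately show ?thesis using ric by simp
qed

text \<open>Skewness of \<open>omega\<close> turns the trace of \<open>S x ** S y\<close> into minus
  \<open>ric_up\<close> at the covectors \<open>G *v x\<close> and \<open>G *v y\<close>.\<close>

lemma ricci_eq:
  assumes sym: "transpose G = G" and inv: "invertible G"
  shows "ricci G mu x y = x \<bullet> (((1/4) *\<^sub>R (G ** ric_up (matrix_inv G) (matrix_inv G) ** G)
    - (1/2) *\<^sub>R ric_down (matrix_inv G) G) *v y)"
proof -
  define Gi where "Gi = matrix_inv G"
  have "x \<bullet> ((G ** ric_up Gi Gi ** G) *v y) = (G *v x) \<bullet> (ric_up Gi Gi *v (G *v y))"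
    using inner_transpose[of G x] by (simp add: sym flip: matrix_vector_mul_assoc)
  then have "x \<bullet> ((G ** ric_up Gi Gi ** G) *v y)
      = - trace (- (Gi ** omega (G *v x)) ** - (Gi ** omega (G *v y)))"
    by (simp add: inner_ric_up transpose_omega matrix_mult.minus_right matrix_mult.minus_left
        trace_minus matrix_mul_assoc)
  then show ?thesis
    by (subst ricci_eq_trace[OF sym inv refl refl])
       (simp add: matrix_vector_mult.diff_left matrix_vector_mult.scaleR_left inner_diff_right
        inner_ric_down matrix_mul_assoc Gi_def)
qed

lemma ric11_eq:
  assumes "transpose G = G" "invertible G"
  defines "R \<equiv> (1/4) *\<^sub>R (G ** ric_up (matrix_inv G) (matrix_inv G) ** G)
    - (1/2) *\<^sub>R ric_down (matrix_inv G) G"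
  shows "ric11 G mu J = (1/2) *\<^sub>R (R + transpose J ** R ** J)"
proof -
  have "ricci G mu (J *v axis i 1) (J *v axis j 1) = (transpose J ** R ** J) $ i $ j" for i j
  proof -
    have "ricci G mu (J *v axis i 1) (J *v axis j 1) = axis i 1 \<bullet> (transpose J *v (R *v (J *v axis j 1)))"
      using inner_transpose[of J "R *v (J *v axis j 1)" "axis i 1"]
      by (simp add: ricci_eq[OF assms(1,2), folded R_def] inner_commute)
    then show ?thesis by (simp add: matrix_vector_mul_assoc matrix_mul_assoc inner_axis_matrix)
  qed
  then show ?thesis
    by (simp add: ric11_def vec_eq_iff ricci_eq[OF assms(1,2), folded R_def] inner_axis_matrix)
qed

end

section \<open>The flow\<close>

locale two_step_complex = two_step_algebra mu for mu :: "real^'n \<Rightarrow> real^'n \<Rightarrow> real^'n" +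
  fixes J :: "real^'n^'n" and V :: "(real^'n) set"
  assumes J_J: "J ** J = - mat 1"
    and mu_V: "mu x y \<in> V"
    and V_central: "v \<in> V \<Longrightarrow> mu v x = 0"
    and J_V: "v \<in> V \<Longrightarrow> J *v v \<in> V"
begin

lemma transpose_J_J: "transpose J ** transpose J = - mat 1"
  by (simp add: J_J transpose_minus flip: matrix_transpose_mul)

text \<open>The coefficients of \<open>field_down\<close> and \<open>field_up\<close> are the 1/2
  and 1/4 of the Ricci form times the 1/2 of the (1,1)-projection. Both signs are positive: the flow
  negates Ricci, and passing to the inverse metric flips the sign once more. \<open>field_up\<close>
  has \<open>J\<close> on the other side because it acts on covectors.\<close>

definition field_down :: "real^'n^'n \<Rightarrow> real^'n^'n \<Rightarrow> real^'n^'n" where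
  "field_down A C = (1/4) *\<^sub>R (ric_down A C + transpose J ** ric_down A C ** J)"

definition field_up :: "real^'n^'n \<Rightarrow> real^'n^'n \<Rightarrow> real^'n^'n" where
  "field_up A C = (1/8) *\<^sub>R (ric_up A C + J ** ric_up A C ** transpose J)"

definition flow_field :: "(real^'n^'n) \<times> (real^'n^'n) \<Rightarrow> (real^'n^'n) \<times> (real^'n^'n)" where
  "flow_field X = (field_down (matrix_inv (fst X)) (matrix_inv (snd X)),
     field_up (matrix_inv (fst X)) (matrix_inv (fst X)))"

text \<open>Increments of \<open>(H, P)\<close>. The first component descends to the quotient by
  \<open>V\<close>; the second is a bivector on \<open>V\<close>, since the \<open>w\<close>
  orthogonal to \<open>V\<close> are the covectors vanishing there. Invariance of the second
  component later lets \<open>J\<close> pass through the inverse of \<open>P\<close>.\<close>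

definition flow_cone :: "((real^'n^'n) \<times> (real^'n^'n)) set" where
  "flow_cone = {X. transpose (fst X) = fst X \<and> transpose (snd X) = snd X \<and>
     J ** snd X ** transpose J = snd X \<and>
     (\<forall>x. 0 \<le> x \<bullet> (fst X *v x)) \<and> (\<forall>x. 0 \<le> x \<bullet> (snd X *v x)) \<and>
     (\<forall>v. v \<in> V \<longrightarrow> fst X *v v = 0) \<and> (\<forall>w. (\<forall>v\<in>V. v \<bullet> w = 0) \<longrightarrow> snd X *v w = 0)}"

lemma convex_cone_flow_cone: "convex_cone flow_cone"
  unfolding convex_cone_iff
  by (auto simp: flow_cone_def transpose_add transpose_scaleR matrix_mult.add_left matrix_mult.add_right
      matrix_mult.scaleR_left matrix_mult.scaleR_right matrix_vector_mult.add_left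
      matrix_vector_mult.scaleR_left inner_add_right)

lemma closed_flow_cone: "closed flow_cone"
  unfolding flow_cone_def
  by (intro closed_Collect_conj closed_Collect_all closed_Collect_imp closed_Collect_eq
      closed_Collect_le continuous_intros matrix_mult.continuous_on matrix_vector_mult.continuous_on
      open_Collect_const)

text \<open>Centrality of \<open>V\<close> kills \<open>ric_down\<close> on \<open>V\<close>, and a
  covector vanishing on \<open>V\<close> has zero \<open>omega\<close>, which kills
  \<open>ric_up\<close>. Averaging over \<open>J\<close> preserves both kernels because
  \<open>J\<close> preserves \<open>V\<close>.\<close>

lemma field_mem_flow_cone:
  assumes A: "transpose A = A" "\<And>x. 0 \<le> x \<bullet> (A *v x)"
    and C: "transpose C = C" "\<And>x. 0 \<le> x \<bullet> (C *v x)"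
  shows "(field_down A C, field_up A A) \<in> flow_cone"
proof -
  define R where "R = ric_down A C"
  define M where "M = ric_up A A"
  have R: "transpose R = R" "\<And>x. 0 \<le> x \<bullet> (R *v x)"
    unfolding R_def by (intro transpose_ric_down ric_down_psd A C)+
  have M: "transpose M = M" "\<And>x. 0 \<le> x \<bullet> (M *v x)"
    unfolding M_def by (intro transpose_ric_up ric_up_psd A)+
  have RV: "R *v v = 0" if "v \<in> V" for v
  proof -
    have "ad v = 0" using V_central[OF that] by (simp add: matrix_eq)
    then have "x \<bullet> (R *v v) = 0" for x by (simp add: R_def inner_ric_down)
    then show ?thesis by (metis inner_eq_zero_iff)
  qed
  have MV: "M *v w = 0" if "\<forall>v\<in>V. v \<bullet> w = 0" for w
  proof -
    have "w \<bullet> mu x y = 0" for x y using that mu_V by (metis inner_commute)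
    then have "omega w = 0" by (simp add: matrix_eq_inner inner_omega)
    then have "x \<bullet> (M *v w) = 0" for x
      using transpose_omega[of w] by (simp add: M_def inner_ric_up)
    then show ?thesis by (metis inner_eq_zero_iff)
  qed
  \<comment> \<open>Dually to \<open>J_V\<close>, the transpose of \<open>J\<close> preserves the
    covectors vanishing on \<open>V\<close>.\<close>
  have JV: "\<forall>v\<in>V. v \<bullet> (transpose J *v w) = 0" if "\<forall>v\<in>V. v \<bullet> w = 0" for w
    using that J_V inner_transpose[of J w] by (metis inner_commute)
  have "J ** (J ** M ** transpose J) ** transpose J = (J ** J) ** M ** (transpose J ** transpose J)"
    by (simp add: matrix_mul_assoc)
  also have "\<dots> = M"
    by (simp add: J_J transpose_J_J matrix_mult.minus_left matrix_mult.minus_right)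
  finally have JM: "J ** (J ** M ** transpose J) ** transpose J = M" .
  show ?thesis
    unfolding flow_cone_def field_down_def field_up_def R_def[symmetric] M_def[symmetric]
    using R M psd_conjugate[OF R(2), of _ J] psd_conjugate[OF M(2), of _ "transpose J"]
    by (auto simp: transpose_add transpose_scaleR matrix_transpose_mul matrix_mul_assoc
        matrix_mult.add_left matrix_mult.add_right matrix_mult.scaleR_left matrix_mult.scaleR_right
        JM[unfolded matrix_mul_assoc] matrix_vector_mult.add_left matrix_vector_mult.scaleR_left
        inner_add_right RV MV)
       (simp_all add: RV MV J_V JV flip: matrix_vector_mul_assoc del: transpose_matrix_vector)
qed

text \<open>\<open>H\<close> and \<open>matrix_inv P\<close> carry the metric on the \<open>g0\<close>-orthogonal complement of \<open>V\<close> and on \<open>V\<close>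
  respectively, and both agree with \<open>g0\<close> on the other summand; hence the formula for \<open>G\<close>.\<close>

lemma ric11_flow:
  assumes g0: "inner_product_matrix g0"
    and X: "(H - g0, P - matrix_inv g0) \<in> flow_cone"
    and H: "inner_product_matrix H" and P: "inner_product_matrix P" and JP: "J ** P ** transpose J = P"
  defines "G \<equiv> H + matrix_inv P - g0"
  assumes G: "inner_product_matrix G"
  shows "field_down (matrix_inv H) (matrix_inv P)
      - matrix_inv P ** field_up (matrix_inv H) (matrix_inv H) ** matrix_inv P = - ric11 G mu J"
proof -
  define A where "A = matrix_inv H"
  define C where "C = matrix_inv P"
  define Gi where "Gi = matrix_inv G"
  define E where "E = H - g0"
  define B where "B = P - matrix_inv g0"
  note inv = inner_product_matrix_invertible
  note A = matrix_inv[OF inv[OF H], folded A_def]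
  note C = matrix_inv[OF inv[OF P], folded C_def]
  note Gi = matrix_inv[OF inv[OF G], folded Gi_def]
  note g0i = matrix_inv[OF inv[OF g0]]
  have sym: "transpose A = A" "transpose C = C" "transpose Gi = Gi" "transpose G = G"
    using H P G inv transpose_matrix_inv by (auto simp: inner_product_matrix_def A_def C_def Gi_def)
  have E: "transpose E = E" "\<And>v. v \<in> V \<Longrightarrow> E *v v = 0"
    and B: "transpose B = B" "\<And>w. \<forall>v\<in>V. v \<bullet> w = 0 \<Longrightarrow> B *v w = 0"
    using X by (auto simp: flow_cone_def E_def B_def)
  \<comment> \<open>If \<open>N\<close> kills \<open>V\<close>, the range of its transpose consists
    of covectors vanishing on \<open>V\<close>, which \<open>B\<close> kills; transposing gives the
    claim.\<close>
  have kill_B: "N ** B = 0" if "\<And>v. v \<in> V \<Longrightarrow> N *v v = 0" for N :: "real^'n^'n"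
  proof -
    have "B *v (transpose N *v y) = 0" for y
      using that inner_transpose[of N y]
      by (intro B(2)) (metis inner_commute inner_zero_right)
    then have "B ** transpose N = 0"
      by (simp add: matrix_eq matrix_vector_mul_assoc del: transpose_matrix_vector)
    then have "transpose (B ** transpose N) = 0" by simp
    then show ?thesis by (simp add: matrix_transpose_mul B(1))
  qed
  have HB: "H ** B = g0 ** B"
    using kill_B[OF E(2)] by (simp add: E_def matrix_mult.diff_left)
  have AgB: "A ** g0 ** B = B"
  proof -
    have "A ** g0 ** B = (A ** H) ** B" by (simp add: HB flip: matrix_mul_assoc)
    then show ?thesis by (simp add: A)
  qed
  \<comment> \<open>The difference of \<open>A\<close> and the true inverse metric factors through
    \<open>B\<close> on the left, so matrices that kill \<open>V\<close> cannot tell them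
    apart.\<close>
  have "A - Gi = - (A ** (H - G) ** Gi)"
    unfolding A_def Gi_def by (rule matrix_inv_diff[OF inv[OF H] inv[OF G]])
  moreover have "H - G = g0 ** B ** C"
    by (simp add: G_def B_def C_def[symmetric] matrix_mult.diff_left matrix_mult.diff_right g0i C
        flip: matrix_mul_assoc)
  ultimately have "A - Gi = - (A ** g0 ** B ** C ** Gi)" by (simp add: matrix_mul_assoc)
  then have AGi: "A - Gi = B ** (- (C ** Gi))"
    by (simp add: AgB matrix_mult.minus_right matrix_mul_assoc)
  have NA: "N ** A = N ** Gi" if "\<And>v. v \<in> V \<Longrightarrow> N *v v = 0" for N :: "real^'n^'n"
  proof -
    have "N ** (A - Gi) = 0" by (simp add: AGi matrix_mul_assoc kill_B[OF that])
    then show ?thesis by (simp add: matrix_mult.diff_right)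
  qed
  \<comment> \<open>The dual statement: \<open>G\<close> and \<open>C\<close> differ by
    \<open>E\<close>, so they agree on whatever \<open>E\<close> kills.\<close>
  have CG: "C ** N = G ** N" if "E ** N = 0" for N :: "real^'n^'n"
  proof -
    have "G = E + C" by (simp add: G_def E_def C_def)
    then show ?thesis by (simp add: matrix_mult.add_left that)
  qed
  have mu_V0: "mu x v = 0" if "v \<in> V" for x v
    using skew_mu[of x v] V_central[OF that] by simp
  have ad_A: "ad x ** A = ad x ** Gi" for x by (rule NA) (simp add: mu_V0)
  have A_ad: "A ** transpose (ad x) = Gi ** transpose (ad x)" for x
    using arg_cong[OF ad_A[of x], of transpose] by (simp add: matrix_transpose_mul sym)
  have om_A: "omega x ** A = omega x ** Gi" for x
  proof (rule NA)
    fix v assume "v \<in> V"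
    then have "y \<bullet> (omega x *v v) = 0" for y by (simp add: inner_omega mu_V0)
    then show "omega x *v v = 0" by (metis inner_eq_zero_iff)
  qed
  have A_om: "A ** transpose (omega x) = Gi ** transpose (omega x)" for x
    using arg_cong[OF om_A[of x], of transpose] by (simp add: matrix_transpose_mul sym)
  have "E ** ad x = 0" for x
    by (simp add: matrix_eq E(2) mu_V flip: matrix_vector_mul_assoc)
  then have C_ad: "C ** ad x = G ** ad x" for x by (rule CG)
  have down: "ric_down A C = ric_down Gi G"
  proof -
    have "A ** transpose (ad x) ** C ** ad y = Gi ** transpose (ad x) ** G ** ad y" for x y
      by (metis A_ad C_ad matrix_mul_assoc)
    then have "x \<bullet> (ric_down A C *v y) = x \<bullet> (ric_down Gi G *v y)" for x y
      by (simp only: inner_ric_down)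
    then show ?thesis by (simp add: matrix_eq_inner)
  qed
  have up: "ric_up A A = ric_up Gi Gi"
  proof -
    have "trace (A ** omega x ** A ** transpose (omega y)) = trace (Gi ** omega x ** Gi ** transpose (omega y))" for x y
    proof -
      \<comment> \<open>The left factor \<open>A\<close> is rotated cyclically so that it too stands
        to the right of an \<open>omega\<close>.\<close>
      have "A ** omega x ** A ** transpose (omega y) = A ** (omega x ** Gi ** transpose (omega y))"
        by (metis om_A matrix_mul_assoc)
      also have "trace \<dots> = trace (omega x ** Gi ** (transpose (omega y) ** A))"
        by (subst trace_mul_sym) (simp add: matrix_mul_assoc)
      also have "transpose (omega y) ** A = transpose (omega y) ** Gi"
        by (simp add: transpose_omega matrix_mult.minus_left om_A)
      also have "trace (omega x ** Gi ** (transpose (omega y) ** Gi))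
          = trace (Gi ** (omega x ** Gi ** transpose (omega y)))"
        by (subst (2) trace_mul_sym) (simp add: matrix_mul_assoc)
      finally show ?thesis by (simp add: matrix_mul_assoc)
    qed
    then show ?thesis by (simp add: matrix_eq_inner inner_ric_up)
  qed
  define M where "M = ric_up A A"
  have M_sym: "transpose M = M" unfolding M_def by (rule transpose_ric_up[OF sym(1)])
  have "E ** M = 0"
  proof -
    have "x \<bullet> ((E ** M) *v y) = 0" for x y
    proof -
      have "(E *v x) \<bullet> mu a b = 0" for a b
        using inner_transpose[of E x "mu a b"] E mu_V by simp
      then have "omega (E *v x) = 0" by (simp add: matrix_eq_inner inner_omega)
      then have "(E *v x) \<bullet> (M *v y) = 0" by (simp add: M_def inner_ric_up)
      then show ?thesis
        using inner_transpose[of E x "M *v y"] E(1) by (simp add: matrix_vector_mul_assoc)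
    qed
    then show ?thesis by (simp add: matrix_eq_inner)
  qed
  then have CM: "C ** M = G ** M" by (rule CG)
  have MC: "M ** C = M ** G"
    using arg_cong[OF CM, of transpose] by (simp add: matrix_transpose_mul sym M_sym)
  have GMG: "G ** M ** G = C ** M ** C" by (metis CM MC matrix_mul_assoc)
  \<comment> \<open>Invariance of \<open>P\<close> under \<open>J\<close>, rewritten for its inverse
    \<open>C\<close>.\<close>
  have CJ: "C ** J = - (transpose J ** C)"
  proof -
    have "C ** J ** P ** transpose J = mat 1" using JP C by (metis matrix_mul_assoc)
    then have "C ** J ** P ** (transpose J ** transpose J) = transpose J" by (simp add: matrix_mul_assoc)
    then have "C ** J ** P = - transpose J"
      by (simp add: transpose_J_J matrix_mult.minus_right minus_equation_iff[of "C ** J ** P"])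
    then have "C ** J ** (P ** C) = - (transpose J ** C)"
      by (simp add: matrix_mul_assoc matrix_mult.minus_left)
    then show ?thesis by (simp add: C)
  qed
  then have JC: "transpose J ** C = - (C ** J)" by simp
  \<comment> \<open>Moving \<open>J\<close> through \<open>C\<close> on both sides, with two
    cancelling signs, turns the average of the lowered form into that of the bivector
    \<open>M\<close>.\<close>
  have JMJ: "transpose J ** (C ** M ** C) ** J = C ** (J ** M ** transpose J) ** C"
  proof -
    have "transpose J ** (C ** M ** C) ** J = (transpose J ** C) ** M ** (C ** J)"
      by (simp add: matrix_mul_assoc)
    also have "\<dots> = (- (C ** J)) ** M ** (- (transpose J ** C))"
      using arg_cong2[OF arg_cong[OF JC, of "\<lambda>Y. Y ** M"] CJ, of "(**)"] .
    also have "\<dots> = C ** J ** M ** (transpose J ** C)"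
      by (simp only: matrix_mult.minus_left matrix_mult.minus_right minus_minus)
    finally show ?thesis by (simp add: matrix_mul_assoc)
  qed
  show ?thesis
    unfolding ric11_eq[OF sym(4) inv[OF G]] A_def[symmetric] C_def[symmetric] Gi_def[symmetric]
      down[symmetric] up[symmetric] M_def[symmetric] GMG field_down_def field_up_def
    by (simp add: matrix_mult.diff_left matrix_mult.diff_right matrix_mult.add_left
        matrix_mult.add_right matrix_mult.scaleR_left matrix_mult.scaleR_right JMJ
        scaleR_add_right scaleR_diff_right)
qed

section \<open>Lipschitz bound and global existence\<close>

lemma flow_cone_shift:
  assumes g: "inner_product_matrix g" and X: "x - g = a" "transpose a = a" "\<And>v. 0 \<le> v \<bullet> (a *v v)"
  shows "inner_product_matrix x" "v \<bullet> (g *v v) \<le> v \<bullet> (x *v v)"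
proof -
  have x: "x = g + a" using X(1) by auto
  show "v \<bullet> (g *v v) \<le> v \<bullet> (x *v v)"
    using X(3) by (simp add: x matrix_vector_mult.add_left inner_add_right)
  show "inner_product_matrix x"
    using g X(2,3) by (auto simp: inner_product_matrix_def x transpose_add ip_def
        matrix_vector_mult.add_left inner_add_right intro: add_pos_nonneg)
qed

text \<open>Adding semidefinite increments keeps the coercivity constants of \<open>g\<close> and
  \<open>h\<close>, so both inverses are bounded and Lipschitz, and the field is bilinear in them.
  The projection \<open>p\<close> in \<open>lip\<close> treats both components at once.\<close>

lemma flow_field_lipschitz:
  assumes "inner_product_matrix g" "inner_product_matrix h"
  shows "\<exists>L. L-lipschitz_on {X. X - (g, h) \<in> flow_cone} flow_field"
proof -
  let ?D = "{X. X - (g, h) \<in> flow_cone}"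
  have lip: "(\<exists>L. L-lipschitz_on ?D (\<lambda>X. matrix_inv (p X))) \<and> bounded ((\<lambda>X. matrix_inv (p X)) ` ?D)"
    if p: "1-lipschitz_on UNIV p" and k: "inner_product_matrix k"
      and pk: "\<And>X. X \<in> ?D \<Longrightarrow> transpose (p X - k) = p X - k \<and> (\<forall>v. 0 \<le> v \<bullet> ((p X - k) *v v))"
    for p :: "(real^'n^'n) \<times> (real^'n^'n) \<Rightarrow> real^'n^'n" and k
  proof -
    obtain c where c: "c > 0" "\<And>v. c * (norm v)\<^sup>2 \<le> v \<bullet> (k *v v)"
      using inner_product_matrix_coercive[OF k] by blast
    have "c * (norm v)\<^sup>2 \<le> v \<bullet> (Y *v v)" if "Y \<in> p ` ?D" for Y v
      using that pk flow_cone_shift(2)[OF k refl] c(2) by (smt (verit) imageE)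
    then have inv: "\<exists>L. L-lipschitz_on (p ` ?D) matrix_inv" "bounded (matrix_inv ` p ` ?D)"
      using matrix_inv_lipschitz[OF c(1), of "p ` ?D"] by blast+
    from inv(1) obtain L where L: "L-lipschitz_on (p ` ?D) matrix_inv" by blast
    have "(L * 1)-lipschitz_on ?D (\<lambda>X. matrix_inv (p X))"
      by (rule lipschitz_on_compose2[OF lipschitz_on_subset[OF p] L]) auto
    then show ?thesis using inv(2) by (auto simp: image_image)
  qed
  have fst: "1-lipschitz_on UNIV (fst :: (real^'n^'n) \<times> (real^'n^'n) \<Rightarrow> _)"
    and snd: "1-lipschitz_on UNIV (snd :: (real^'n^'n) \<times> (real^'n^'n) \<Rightarrow> _)"
    by (rule lipschitz_onI; simp only: mult_1 dist_fst_le dist_snd_le zero_le_one)+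
  have A: "\<exists>L. L-lipschitz_on ?D (\<lambda>X. matrix_inv (fst X))" "bounded ((\<lambda>X. matrix_inv (fst X)) ` ?D)"
    using lip[OF fst assms(1)] by (auto simp: flow_cone_def)
  have C: "\<exists>L. L-lipschitz_on ?D (\<lambda>X. matrix_inv (snd X))" "bounded ((\<lambda>X. matrix_inv (snd X)) ` ?D)"
    using lip[OF snd assms(2)] by (auto simp: flow_cone_def)
  have "bounded_bilinear field_down"
    unfolding field_down_def
    by (rule bounded_bilinear_linear_compose[OF _ bounded_bilinear_ric_down])
       (auto intro!: linearI simp: matrix_mult.add_left matrix_mult.add_right
        matrix_mult.scaleR_left matrix_mult.scaleR_right scaleR_add_right)
  from lipschitz_on_bilinear(1)[OF this A C] obtain L1 where
    L1: "L1-lipschitz_on ?D (\<lambda>X. field_down (matrix_inv (fst X)) (matrix_inv (snd X)))" by blast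
  have "bounded_bilinear field_up"
    unfolding field_up_def
    by (rule bounded_bilinear_linear_compose[OF _ bounded_bilinear_ric_up])
       (auto intro!: linearI simp: matrix_mult.add_left matrix_mult.add_right
        matrix_mult.scaleR_left matrix_mult.scaleR_right scaleR_add_right)
  from lipschitz_on_bilinear(1)[OF this A A] obtain L2 where
    L2: "L2-lipschitz_on ?D (\<lambda>X. field_up (matrix_inv (fst X)) (matrix_inv (fst X)))" by blast
  show ?thesis
    unfolding flow_field_def using lipschitz_on_Pair[OF L1 L2] by blast
qed

lemma long_time_solution:
  assumes g0: "hermitian J g0"
  shows "\<exists>g. g 0 = g0 \<and> (\<forall>t\<ge>0. inner_product_matrix (g t) \<and>
    (g has_vector_derivative (- ric11 (g t) mu J)) (at t within {0..}))"
proof -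
  have ip0: "inner_product_matrix g0" using g0 by (simp add: hermitian_def)
  note inv0 = matrix_inv[OF inner_product_matrix_invertible[OF ip0]]
  define h0 where "h0 = matrix_inv g0"
  have iph: "inner_product_matrix h0" unfolding h0_def by (rule inner_product_matrix_inv[OF ip0])
  have "transpose J ** g0 ** J = g0"
  proof -
    have "x \<bullet> ((transpose J ** g0 ** J) *v y) = x \<bullet> (g0 *v y)" for x y
      using g0 inner_transpose[of J "g0 *v (J *v y)" x]
      by (simp add: hermitian_def ip_def inner_commute flip: matrix_vector_mul_assoc)
    then show ?thesis by (simp add: matrix_eq_inner)
  qed
  \<comment> \<open>This shows \<open>J ** h0 ** transpose J\<close> to be a right inverse of
    \<open>g0\<close>, hence equal to \<open>h0\<close>: the initial \<open>P\<close> is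
    \<open>J\<close>-invariant.\<close>
  then have "g0 ** (J ** h0 ** transpose J) = transpose J ** g0 ** (J ** J) ** h0 ** transpose J"
    by (metis matrix_mul_assoc)
  also have "\<dots> = - (transpose J ** (g0 ** h0) ** transpose J)"
    by (simp add: J_J matrix_mult.minus_left matrix_mult.minus_right matrix_mul_assoc)
  also have "\<dots> = mat 1" by (simp add: h0_def inv0 transpose_J_J)
  finally have "h0 ** (g0 ** (J ** h0 ** transpose J)) = h0" by simp
  then have Jh: "J ** h0 ** transpose J = h0" by (simp add: matrix_mul_assoc h0_def inv0)
  have mem: "inner_product_matrix (fst X)" "inner_product_matrix (snd X)"
    "J ** snd X ** transpose J = snd X" if "X - (g0, h0) \<in> flow_cone" for X
  proof -
    show "inner_product_matrix (fst X)" "inner_product_matrix (snd X)"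
      using that flow_cone_shift(1)[OF ip0 refl] flow_cone_shift(1)[OF iph refl]
      by (auto simp: flow_cone_def)
    have "J ** (snd X - h0) ** transpose J = snd X - h0" using that by (simp add: flow_cone_def)
    then show "J ** snd X ** transpose J = snd X"
      by (simp add: matrix_mult.diff_left matrix_mult.diff_right Jh)
  qed
  have pos: "transpose (matrix_inv k) = matrix_inv k" "0 \<le> x \<bullet> (matrix_inv k *v x)"
    if "inner_product_matrix k" for k x
    using inner_product_matrix_inv[OF that]
    by (simp_all add: inner_product_matrix_def ip_def) (metis inner_zero_left less_eq_real_def)
  obtain L where L: "L-lipschitz_on {X. X - (g0, h0) \<in> flow_cone} flow_field"
    using flow_field_lipschitz[OF ip0 iph] by blast
  have "flow_field X \<in> flow_cone" if "X - (g0, h0) \<in> flow_cone" for X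
    unfolding flow_field_def by (intro field_mem_flow_cone pos mem that)
  from global_solution_in_cone[OF convex_cone_flow_cone closed_flow_cone L this]
  obtain u where u0: "u 0 = (g0, h0)" and uK: "\<And>t. t \<ge> 0 \<Longrightarrow> u t - (g0, h0) \<in> flow_cone"
    and du: "\<And>t. t \<ge> 0 \<Longrightarrow> (u has_vector_derivative flow_field (u t)) (at t within {0..})"
    by blast
  define C where "C t = matrix_inv (snd (u t))" for t
  define g where "g t = fst (u t) + C t - g0" for t
  show ?thesis
  proof (intro exI[of _ g] conjI allI impI)
    show "g 0 = g0"
    proof -
      have "C 0 = matrix_inv h0 ** (h0 ** g0)" by (simp add: C_def u0 h0_def inv0)
      also have "\<dots> = g0"
        by (simp add: matrix_mul_assoc matrix_inv[OF inner_product_matrix_invertible[OF iph]])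
      finally show ?thesis by (simp add: g_def u0)
    qed
    fix t :: real assume t: "t \<ge> 0"
    note m = mem[OF uK[OF t]]
    have ipC: "inner_product_matrix (C t)" unfolding C_def by (rule inner_product_matrix_inv[OF m(2)])
    \<comment> \<open>The metric is \<open>C t\<close> plus a semidefinite increment, so it stays
      positive definite.\<close>
    have "g t - C t = fst (u t) - g0" by (simp add: g_def)
    then show ipg: "inner_product_matrix (g t)"
      using uK[OF t] by (intro flow_cone_shift(1)[OF ipC]) (auto simp: flow_cone_def)
    have d1: "((\<lambda>s. fst (u s)) has_vector_derivative fst (flow_field (u t))) (at t within {0..})"
      and d2: "((\<lambda>s. snd (u s)) has_vector_derivative snd (flow_field (u t))) (at t within {0..})"
      by (rule bounded_linear.has_vector_derivative[OF bounded_linear_fst du[OF t]]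
          bounded_linear.has_vector_derivative[OF bounded_linear_snd du[OF t]])+
    \<comment> \<open>One coercivity constant, that of \<open>h0\<close>, serves for all times; it
      makes inversion continuous along the curve.\<close>
    obtain c where c: "c > 0" "\<And>v. c * (norm v)\<^sup>2 \<le> v \<bullet> (h0 *v v)"
      using inner_product_matrix_coercive[OF iph] by blast
    have "c * (norm v)\<^sup>2 \<le> v \<bullet> (snd (u s) *v v)" if "s \<in> {0..}" for s v
      using uK[of s] that flow_cone_shift(2)[OF iph refl, of "snd (u s)" v] c(2)[of v]
      by (auto simp: flow_cone_def)
    then have "\<exists>L. L-lipschitz_on ((\<lambda>s. snd (u s)) ` {0..}) matrix_inv"
      by (intro matrix_inv_lipschitz(1)[OF c(1)]) blast
    moreover have "continuous_on {0..} u"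
      by (rule continuous_on_vector_derivative[of _ _ "\<lambda>t. flow_field (u t)"]) (use du in auto)
    ultimately have "continuous_on {0..} C"
      unfolding C_def
      by (intro continuous_on_compose2[OF _ continuous_on_snd[of _ u]])
         (auto intro: lipschitz_on_continuous_on)
    then have "(C has_vector_derivative - (C t ** snd (flow_field (u t)) ** C t)) (at t within {0..})"
      unfolding C_def using t inner_product_matrix_invertible[OF mem(2)[OF uK]]
      by (intro has_vector_derivative_matrix_inv d2) auto
    then have "(g has_vector_derivative fst (flow_field (u t)) - C t ** snd (flow_field (u t)) ** C t)
        (at t within {0..})"
      unfolding g_def using d1 by (auto intro!: derivative_eq_intros)
    moreover have "fst (flow_field (u t)) - C t ** snd (flow_field (u t)) ** C t = - ric11 (g t) mu J"
      using ric11_flow[OF ip0 _ m, folded C_def] uK[OF t] ipg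
      by (cases "u t") (simp add: flow_field_def h0_def C_def g_def)
    ultimately show "(g has_vector_derivative - ric11 (g t) mu J) (at t within {0..})" by simp
  qed
qed

end

theorem theorem5p4:
  fixes mu :: "real^'n \<Rightarrow> real^'n \<Rightarrow> real^'n" and J :: "real^'n^'n" and g0 :: "real^'n^'n"
  assumes "lie_bracket mu"
    and "two_step_nilpotent mu"
    and "complex_structure mu J"
    and "(\<lambda>x. J *v x) ` commutator mu \<subseteq> commutator mu"
    and "hermitian J g0"
  shows "\<exists>g :: real \<Rightarrow> real^'n^'n. g 0 = g0 \<and>
           (\<forall>t\<ge>0. inner_product_matrix (g t) \<and>
              (g has_vector_derivative (- ric11 (g t) mu J)) (at t within {0..}))"
proof -
  have bil: "bilinear mu" using assms(1) by (simp add: lie_bracket_def)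
  have nil: "mu (mu x y) z = 0" for x y z using assms(2) by (simp add: two_step_nilpotent_def)
  interpret two_step_complex mu J "commutator mu"
  proof
    show "bilinear mu" by (rule bil)
    show "mu x y = - mu y x" for x y using assms(1) unfolding lie_bracket_def by blast
    show "mu (mu x y) z = 0" for x y z by (rule nil)
    show "J ** J = - mat 1" using assms(3) by (simp add: complex_structure_def)
    show "mu x y \<in> commutator mu" for x y by (auto simp: commutator_def intro: span_base)
    show "J *v v \<in> commutator mu" if "v \<in> commutator mu" for v using that assms(4) by blast
    show "mu v x = 0" if "v \<in> commutator mu" for v x
    proof -
      \<comment> \<open>Centrality passes from single brackets to their span because the vectors
        bracketing to zero with \<open>x\<close> form a subspace.\<close>
      have "subspace {v. mu v x = 0}"
        by (simp add: subspace_def bilinear_lzero[OF bil] bilinear_ladd[OF bil] bilinear_lmul[OF bil])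
      then have "commutator mu \<subseteq> {v. mu v x = 0}"
        unfolding commutator_def by (rule_tac span_minimal) (auto simp: nil)
      then show ?thesis using that by blast
    qed
  qed
  show ?thesis by (rule long_time_solution[OF assms(5)])
qed

end
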